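(* Let $\mathcal{C}_2$ be a finite family of two-dimensional spherical polyhedral cells in $S^2$ whose interiors are pairwise disjoint and which satisfy $\sigma\left(S^2\setminus\bigcup_{C\in\mathcal{C}_2}\operatorname{int}C\right)=0$. Let $F:S^2\to\mathbb{R}$ be measurable and suppose that for every $C\in\mathcal{C}_2$ there is a nonzero vector $a_C\in\mathbb{R}^3$ with $F(u)=a_C\cdot u$ for all $u\in\operatorname{int}C$. Put $D_C=\|a_C\|$ and, for $|t|<D_C$, let $\Theta_C(t)$ be the angular aperture about the axis $a_C/D_C$ of the part of the level circle $\{u\in S^2: a_C\cdot u=t\}$ lying in $\operatorname{int}C$. Let $U$ be uniformly distributed on $S^2$. Then the law of $F(U)$ is absolutely continuous (in particular, a jump of a chosen density representative at an endpoint or critical value does not represent an atom). For almost every $t\in\mathbb{R}$, a density representative is $$f_F(t)=\frac{1}{4\pi}\sum_{\substack{C\in\mathcal{C}_2\\ |t|<D_C}}\frac{\mathcal{H}^1\left(\operatorname{int}C\cap\{u\in S^2:a_C\cdot u=t\}\right)}{\sqrt{D_C^2-t^2}},$$ or, equivalently, $$f_F(t)=\frac{1}{4\pi}\sum_{\substack{C\in\mathcal{C}_2\\ |t|<D_C}}\frac{\Theta_C(t)}{D_C}.$$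
   Context: $S^2$ is the unit sphere of $\mathbb{R}^3$, $\sigma$ is the rotation-invariant probability measure on $S^2$, and $\mathcal{H}^1$ is one-dimensional Hausdorff measure. A two-dimensional spherical polyhedral cell is a subset of $S^2$ cut out by finitely many hemispherical inequalities $b_j\cdot u\ge 0$ and having nonempty interior in $S^2$; $\operatorname{int}C$ denotes its interior in $S^2$. (The boundaries of the cells therefore lie in finitely many great circles.) Angular aperture: choose an orthonormal basis $e_1,e_2$ of $a_C^{\perp}$ and write points of the level circle as $u(\theta)=\frac{t}{D_C}\hat a_C+\sqrt{1-t^2/D_C^2}\,(\cos\theta\,e_1+\sin\theta\,e_2)$ with $\hat a_C=a_C/D_C$; then $\Theta_C(t)$ is the Lebesgue measure of $\{\theta\in[0,2\pi): u(\theta)\in\operatorname{int}C\}$. *)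

theory Defs
  imports "HOL-Probability.Probability"
begin

definition rotation_invariant_prob :: "(real^3) measure \<Rightarrow> bool" where
  "rotation_invariant_prob \<sigma> \<longleftrightarrow>
     prob_space \<sigma> \<and>
     sets \<sigma> = sets (restrict_space borel (sphere 0 1)) \<and>
     (\<forall>Q::real^3^3. rotation_matrix Q \<longrightarrow> distr \<sigma> \<sigma> ((*v) Q) = \<sigma>)"

(* Existence: the cone measure, i.e. the radial projection to the sphere of the uniform
   distribution on the punctured unit ball. *)
lemma rotation_invariant_prob_exists: "\<exists>\<sigma>. rotation_invariant_prob \<sigma>"
proof -
  define S :: "(real^3) measure" where "S = restrict_space borel (sphere 0 1)"
  define A :: "(real^3) set" where "A = ball 0 1 - {0}"
  define p :: "real^3 \<Rightarrow> real^3" where "p x = (if x = 0 then axis 1 1 else x /\<^sub>R norm x)" for x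
  define \<mu> :: "(real^3) measure" where "\<mu> = uniform_measure lborel A"
  define \<sigma> where "\<sigma> = distr \<mu> S p"
  have A_sets [measurable]: "A \<in> sets borel"
    by (simp add: A_def)
  have A_em: "emeasure lborel A = emeasure lborel (ball 0 1 :: (real^3) set)"
    unfolding A_def by (rule emeasure_Diff_null_set) auto
  have A_pos: "emeasure lborel A \<noteq> 0" "emeasure lborel A \<noteq> \<infinity>"
    unfolding A_em using content_ball_pos[of 1 "0::real^3"] emeasure_lborel_ball_finite[of "0::real^3" 1]
    by (auto simp: measure_def)
  have A_ne: "\<not> A \<in> null_sets lborel"
    using A_pos by auto
  have p_borel [measurable]: "p \<in> borel_measurable borel"
    unfolding p_def by measurable
  have p_sphere: "norm (p x) = 1" for x
    by (simp add: p_def)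
  have p_meas: "p \<in> measurable \<mu> S"
    unfolding S_def by (rule measurable_restrict_space2) (auto simp: p_sphere \<mu>_def cong: measurable_cong_sets)
  have \<mu>_prob: "prob_space \<mu>"
    unfolding \<mu>_def by (rule prob_space_uniform_measure) (use A_pos in auto)
  have \<sigma>_prob: "prob_space \<sigma>"
    unfolding \<sigma>_def by (rule prob_space.prob_space_distr[OF \<mu>_prob p_meas])
  have \<sigma>_sets: "sets \<sigma> = sets S"
    by (simp add: \<sigma>_def)
  have \<sigma>_space: "space \<sigma> = sphere 0 1"
    by (simp add: \<sigma>_def S_def space_restrict_space)
  have em: "emeasure \<sigma> B = emeasure lborel (A \<inter> p -` B) / emeasure lborel A" if "B \<in> sets S" for B
  proof -
    have B: "B \<in> sets borel"
      using that by (auto simp: S_def sets_restrict_space_iff)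
    have "emeasure \<sigma> B = emeasure \<mu> (p -` B)"
      unfolding \<sigma>_def by (subst emeasure_distr[OF p_meas that]) (simp add: \<mu>_def)
    then show ?thesis
      using B measurable_sets[OF p_borel B] unfolding \<mu>_def by (simp add: emeasure_uniform_measure)
  qed
  have inv: "distr \<sigma> \<sigma> ((*v) Q) = \<sigma>" if Q: "rotation_matrix Q" for Q :: "real^3^3"
  proof -
    have orth: "orthogonal_transformation ((*v) Q)"
      using Q by (simp add: rotation_matrix_def orthogonal_transformation_matrix)
    have nrm: "norm (Q *v x) = norm x" for x
      using orth by (simp add: orthogonal_transformation_norm)
    have Qm: "(*v) Q \<in> borel_measurable borel"
      by (intro borel_measurable_continuous_onI matrix_vector_mult_linear_continuous_on)
    have QS: "(*v) Q \<in> measurable S S"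
      unfolding S_def
      by (rule measurable_restrict_space2)
         (auto simp: space_restrict_space nrm intro: measurable_restrict_space1 Qm)
    have Q\<sigma>: "(*v) Q \<in> measurable \<sigma> \<sigma>"
      using QS by (simp add: \<sigma>_sets cong: measurable_cong_sets)
    show ?thesis
    proof (rule measure_eqI)
      fix B assume "B \<in> sets (distr \<sigma> \<sigma> ((*v) Q))"
      then have BS: "B \<in> sets S"
        by (simp add: \<sigma>_sets)
      define B' where "B' = (*v) Q -` B \<inter> sphere 0 1"
      have B'S: "B' \<in> sets S"
        using measurable_sets[OF QS BS] by (simp add: B'_def S_def space_restrict_space)
      have pQ: "p (Q *v x) = Q *v p x" if "x \<noteq> 0" for x
        using that nrm[of x] by (auto simp: p_def matrix_vector_mult_scaleR)
      have img: "(*v) Q ` (A \<inter> p -` B') = A \<inter> p -` B"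
      proof (intro equalityI subsetI)
        fix y assume "y \<in> (*v) Q ` (A \<inter> p -` B')"
        then obtain x where x: "y = Q *v x" "x \<in> A" "p x \<in> B'" by auto
        then have "x \<noteq> 0" "norm x < 1" by (auto simp: A_def)
        moreover from this have "y \<noteq> 0" "norm y < 1"
          using nrm[of x] x(1) by (metis norm_eq_zero, simp)
        ultimately show "y \<in> A \<inter> p -` B"
          using x pQ[of x] by (auto simp: A_def B'_def)
      next
        fix y assume y: "y \<in> A \<inter> p -` B"
        obtain x where x: "y = Q *v x"
          using orthogonal_transformation_surj[OF orth] by (metis surjD)
        have "x \<noteq> 0" "norm x < 1"
          using y x nrm[of x] by (auto simp: A_def)
        then show "y \<in> (*v) Q ` (A \<inter> p -` B')"
          using y x pQ[of x] p_sphere[of x] by (auto simp: A_def B'_def)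
      qed
      have bor: "A \<inter> p -` D \<in> sets borel" if "D \<in> sets S" for D
      proof -
        have "D \<in> sets borel"
          using that by (auto simp: S_def sets_restrict_space_iff)
        then show ?thesis
          using measurable_sets[OF p_borel] by auto
      qed
      have fin: "A \<inter> p -` D \<in> lmeasurable" if "D \<in> sets S" for D
        by (rule bounded_set_imp_lmeasurable)
           (use bor[OF that] in \<open>auto simp: A_def intro: bounded_subset[OF bounded_ball[of 0 1]]\<close>)
      have leb: "emeasure lborel (A \<inter> p -` D) = ennreal (measure lebesgue (A \<inter> p -` D))" if "D \<in> sets S" for D
        using emeasure_eq_measure2[OF fin[OF that]] emeasure_completion[of "A \<inter> p -` D" lborel] bor[OF that] by simp
      have "emeasure lborel (A \<inter> p -` B') = emeasure lborel (A \<inter> p -` B)"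
        using measure_orthogonal_image[OF orth fin[OF B'S]] by (simp add: leb[OF BS] leb[OF B'S] img)
      then have "emeasure \<sigma> B' = emeasure \<sigma> B"
        by (simp add: em BS B'S)
      then show "emeasure (distr \<sigma> \<sigma> ((*v) Q)) B = emeasure \<sigma> B"
        using BS by (simp add: emeasure_distr[OF Q\<sigma>] \<sigma>_sets B'_def \<sigma>_space)
    qed simp
  qed
  have "rotation_invariant_prob \<sigma>"
    using \<sigma>_prob \<sigma>_sets inv by (simp add: rotation_invariant_prob_def S_def)
  then show ?thesis ..
qed

(* In dimension one the factor diameter^s of the s-dimensional Hausdorff measure is the diameter
   itself, and with this normalisation H^1 of a segment is its length.  Boundedness of the covering
   sets is required because the library's diameter carries no information about unbounded sets. *)
definition hausdorff1_pre :: "real \<Rightarrow> 'a::metric_space set \<Rightarrow> ennreal" where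
  "hausdorff1_pre \<delta> A =
     (INF E\<in>{E :: nat \<Rightarrow> 'a set. A \<subseteq> (\<Union>i. E i) \<and> (\<forall>i. bounded (E i) \<and> diameter (E i) \<le> \<delta>)}.
        (\<Sum>i. ennreal (diameter (E i))))"

definition hausdorff1 :: "'a::metric_space set \<Rightarrow> ennreal" where
  "hausdorff1 A = (SUP \<delta>\<in>{0<..}. hausdorff1_pre \<delta> A)"

abbreviation sphere_interior :: "(real^3) set \<Rightarrow> (real^3) set" where
  "sphere_interior C \<equiv> (top_of_set (sphere 0 1)) interior_of C"

definition spherical_cell :: "(real^3) set \<Rightarrow> bool" where
  "spherical_cell C \<longleftrightarrow>
     (\<exists>B. finite B \<and> 0 \<notin> B \<and> C = {u \<in> sphere 0 1. \<forall>b\<in>B. b \<bullet> u \<ge> 0}) \<and>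
     sphere_interior C \<noteq> {}"

definition level_circle :: "real^3 \<Rightarrow> real \<Rightarrow> (real^3) set" where
  "level_circle a t = {u \<in> sphere 0 1. a \<bullet> u = t}"

definition orthonormal_basis_perp :: "real^3 \<Rightarrow> real^3 \<Rightarrow> real^3 \<Rightarrow> bool" where
  "orthonormal_basis_perp a e1 e2 \<longleftrightarrow>
     norm e1 = 1 \<and> norm e2 = 1 \<and> orthogonal e1 e2 \<and> span {e1, e2} = {a}\<^sup>\<bottom>"

definition level_circle_point :: "real^3 \<Rightarrow> real^3 \<Rightarrow> real^3 \<Rightarrow> real \<Rightarrow> real \<Rightarrow> real^3" where
  "level_circle_point a e1 e2 t \<theta> =
     (t / norm a) *\<^sub>R (a /\<^sub>R norm a)
     + sqrt (1 - t\<^sup>2 / (norm a)\<^sup>2) *\<^sub>R (cos \<theta> *\<^sub>R e1 + sin \<theta> *\<^sub>R e2)"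

definition angular_aperture ::
    "(real^3) set \<Rightarrow> real^3 \<Rightarrow> real^3 \<Rightarrow> real^3 \<Rightarrow> real \<Rightarrow> ennreal" where
  "angular_aperture C a e1 e2 t =
     emeasure lborel {\<theta> \<in> {0..<2*pi}. level_circle_point a e1 e2 t \<theta> \<in> sphere_interior C}"

end

(* A rotation-invariant probability on the sphere gives equal mass to balls of equal radius, hence is
   unique. The image of the normalized Lebesgue measure on the cylinder (-1,1) x (0,2 pi) under the
   Archimedes map (s,theta) |-> s a + sqrt (1 - s^2) (cos theta e1 + sin theta e2) is, by spherical
   coordinates in the ball, the cone measure; so it does not depend on the orthonormal frame (a,e1,e2),
   is rotation invariant, and equals sigma. On a cell, F depends on the height s = t / D alone, and
   Fubini in (s,theta) with the frame adapted to a_C gives the contribution Theta_C(t) / (4 pi D_C) to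
   the density. The level circle has radius sqrt (1 - t^2 / D_C^2), and on a circle H^1 is radius
   times angle. *)
theory Submission
  imports Defs
begin

text \<open>The measure \<sigma> is given only through its invariance, so integrating against it
  requires an explicit model. Invariance of the Archimedes image is not visible in its formula: a
  rotation replaces the frame by another one, and no simple change of height and angle undoes this.
  Volumes of cones in the unit ball remove the obstacle, because they are defined without a frame.
  The Jacobian in radius, height and angle is the squared radius and does not involve the height;
  this is why the matching measure on the cylinder is uniform. The cylinder has area 2 * 2 pi, which
  is the 4 pi of the density. For arcs, the two inequalities for H^1 are of different nature. Chords
  never exceed arcs, which settles the upper bound globally. In the other direction, the ratio of
  chord to arc is close to 1 only for nearby points, and the parameter interval is cut at a point
  where the circle closes up, so the lower bound is local and needs a limit.\<close>

subsection \<open>Uniqueness of uniformly distributed measures\<close>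

text \<open>
  Christensen's argument. Integrating the ball of radius \<open>r\<close> over both measures and exchanging the
  integrals gives equal ball measures \<open>h r\<close>. On the part \<open>W n\<close> of \<open>V\<close> whose \<open>r\<close>-balls stay inside \<open>V\<close>,
  the same exchange, now restricted to \<open>V\<close>, gives \<open>h r * \<mu> (W n) \<le> h r * \<nu> V\<close>.
\<close>

lemma emeasure_open_le_of_uniformly_distributed:
  fixes \<mu> \<nu> :: "'a::{metric_space,second_countable_topology} measure"
  assumes "prob_space \<mu>" "prob_space \<nu>"
    and sets_eq[measurable_cong]: "sets \<mu> = sets borel" "sets \<nu> = sets borel"
    and S: "AE x in \<mu>. x \<in> S" "AE x in \<nu>. x \<in> S"
    and ball_\<mu>: "\<And>x y r. x \<in> S \<Longrightarrow> y \<in> S \<Longrightarrow> emeasure \<mu> (ball x r) = emeasure \<mu> (ball y r)"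
    and ball_\<nu>: "\<And>x y r. x \<in> S \<Longrightarrow> y \<in> S \<Longrightarrow> emeasure \<nu> (ball x r) = emeasure \<nu> (ball y r)"
    and "open V"
  shows "emeasure \<mu> V \<le> emeasure \<nu> V"
proof -
  interpret \<mu>: prob_space \<mu> by fact
  interpret \<nu>: prob_space \<nu> by fact
  interpret P: pair_sigma_finite \<mu> \<nu> ..
  obtain x0 where x0: "x0 \<in> S"
    using eventually_happens'[OF \<mu>.ae_filter_bot S(1)] by blast
  note [measurable] = borel_open[OF \<open>open V\<close>]
  have [measurable]: "ball x r \<in> sets borel" for x :: 'a and r
    by simp
  have pred[measurable]: "Measurable.pred (\<mu> \<Otimes>\<^sub>M \<nu>) (\<lambda>p. dist (fst p) (snd p) < r)" for r
    by measurable
  have ind_\<nu>: "(\<integral>\<^sup>+y. indicator {p. dist (fst p) (snd p) < r} (x, y) \<partial>\<nu>) = emeasure \<nu> (ball x r)" for x r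
  proof -
    have "indicator {p. dist (fst p) (snd p) < r} (x, y) = (indicator (ball x r) y :: ennreal)" for y
      by (simp add: indicator_def)
    then show ?thesis by simp
  qed
  have ind_\<mu>: "(\<integral>\<^sup>+x. indicator {p. dist (fst p) (snd p) < r} (x, y) \<partial>\<mu>) = emeasure \<mu> (ball y r)" for y r
  proof -
    have "indicator {p. dist (fst p) (snd p) < r} (x, y) = (indicator (ball y r) x :: ennreal)" for x
      by (simp add: indicator_def dist_commute)
    then show ?thesis by simp
  qed
  have Sc_\<mu>: "(\<integral>\<^sup>+x. f x \<partial>\<mu>) = c" if "\<And>x. x \<in> S \<Longrightarrow> f x = c" for f and c :: ennreal
  proof -
    have "(\<integral>\<^sup>+x. f x \<partial>\<mu>) = (\<integral>\<^sup>+x. c \<partial>\<mu>)"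
      using S(1) by (intro nn_integral_cong_AE) (erule eventually_mono, rule that)
    then show ?thesis by (simp add: \<mu>.emeasure_space_1)
  qed
  have Sc_\<nu>: "(\<integral>\<^sup>+x. f x \<partial>\<nu>) = c" if "\<And>x. x \<in> S \<Longrightarrow> f x = c" for f and c :: ennreal
  proof -
    have "(\<integral>\<^sup>+x. f x \<partial>\<nu>) = (\<integral>\<^sup>+x. c \<partial>\<nu>)"
      using S(2) by (intro nn_integral_cong_AE) (erule eventually_mono, rule that)
    then show ?thesis by (simp add: \<nu>.emeasure_space_1)
  qed
  have same: "emeasure \<mu> (ball x0 r) = emeasure \<nu> (ball x0 r)" for r
  proof -
    have "emeasure \<nu> (ball x0 r) = (\<integral>\<^sup>+x. \<integral>\<^sup>+y. indicator {p. dist (fst p) (snd p) < r} (x, y) \<partial>\<nu> \<partial>\<mu>)"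
      unfolding ind_\<nu> by (rule Sc_\<mu>[symmetric]) (rule ball_\<nu>[OF _ x0])
    also have "\<dots> = (\<integral>\<^sup>+y. \<integral>\<^sup>+x. indicator {p. dist (fst p) (snd p) < r} (x, y) \<partial>\<mu> \<partial>\<nu>)"
      by (rule P.Fubini'[symmetric]) measurable
    also have "\<dots> = emeasure \<mu> (ball x0 r)"
      unfolding ind_\<mu> by (rule Sc_\<nu>) (rule ball_\<mu>[OF _ x0])
    finally show ?thesis ..
  qed
  \<comment> \<open>If one ball of radius \<open>r\<close> were null, all of them centred in
    \<open>S\<close> would be, and by separability countably many of them cover \<open>S\<close>.
    Positivity permits cancelling the ball mass in the final inequality.\<close>
  have pos: "emeasure \<nu> (ball x0 r) > 0" if "r > 0" for r
  proof (rule ccontr)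
    assume "\<not> ?thesis"
    then have null: "ball x r \<in> null_sets \<nu>" if "x \<in> S" for x
      using ball_\<nu>[OF that x0, of r] by (intro null_setsI) auto
    obtain T where T: "countable T" "T \<subseteq> S" "S \<subseteq> closure T"
      using separable by blast
    have "(\<Union>t\<in>T. ball t r) \<in> null_sets \<nu>"
      using T null by (intro null_sets_UN') auto
    moreover have "S \<subseteq> (\<Union>t\<in>T. ball t r)"
    proof
      fix x assume "x \<in> S"
      then obtain t where "t \<in> T" "dist t x < r"
        using T(3) \<open>r > 0\<close> by (meson closure_approachable subsetD)
      then show "x \<in> (\<Union>t\<in>T. ball t r)" by auto
    qed
    ultimately have "(\<Union>t\<in>T. ball t r) \<in> null_sets \<nu>" "S \<subseteq> (\<Union>t\<in>T. ball t r)"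
      by auto
    from AE_not_in[OF this(1)] S(2) have "AE x in \<nu>. False"
      by eventually_elim (use \<open>S \<subseteq> (\<Union>t\<in>T. ball t r)\<close> in blast)
    then show False
      by (simp add: \<nu>.AE_False)
  qed
  define W where "W n = {x. ball x (1 / Suc n) \<subseteq> V}" for n
  \<comment> \<open>By symmetry of the distance, the complement is a union of balls centred outside
    \<open>V\<close>. Closedness supplies the measurability needed for the exchange of
    integrals.\<close>
  have W_closed: "closed (W n)" for n
  proof -
    have "- W n = (\<Union>y\<in>-V. ball y (1 / Suc n))"
      by (auto simp: W_def dist_commute)
    then show ?thesis
      by (metis closed_def open_UN open_ball)
  qed
  have [measurable]: "W n \<in> sets borel" for n
    using W_closed by auto
  have W_inc: "incseq W"
    unfolding W_def
  proof (intro incseq_SucI Collect_mono impI)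
    fix n x assume "ball x (1 / Suc n) \<subseteq> V"
    moreover have "ball x (1 / Suc (Suc n)) \<subseteq> ball x (1 / Suc n)"
      by (rule subset_ball) (simp add: frac_le)
    ultimately show "ball x (1 / Suc (Suc n)) \<subseteq> V" by blast
  qed
  have W_Un: "(\<Union>n. W n) = V"
  proof safe
    show "x \<in> V" if "x \<in> W n" for x n
      using that by (auto simp: W_def)
    show "x \<in> (\<Union>n. W n)" if xV: "x \<in> V" for x
    proof -
      obtain e where e: "e > 0" "ball x e \<subseteq> V"
        using openE[OF \<open>open V\<close> xV] by blast
      obtain n where "1 / Suc n < e"
        using e(1) nat_approx_posE by blast
      then have "x \<in> W n"
        using e by (force simp: W_def)
      then show ?thesis by blast
    qed
  qed
  have "emeasure \<mu> (W n) \<le> emeasure \<nu> V" for n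
  proof -
    let ?r = "1 / real (Suc n)"
    let ?h = "emeasure \<nu> (ball x0 ?r)"
    have "?h * emeasure \<mu> (W n) = (\<integral>\<^sup>+x. ?h * indicator (W n) x \<partial>\<mu>)"
      by (subst nn_integral_cmult_indicator) auto
    also have "\<dots> = (\<integral>\<^sup>+x. emeasure \<nu> (ball x ?r) * indicator (W n) x \<partial>\<mu>)"
      using S(1) by (intro nn_integral_cong_AE) (erule eventually_mono, subst ball_\<nu>[OF x0], assumption, rule refl)
    also have "\<dots> \<le> (\<integral>\<^sup>+x. \<integral>\<^sup>+y. indicator {p. dist (fst p) (snd p) < ?r} (x, y) * indicator V y \<partial>\<nu> \<partial>\<mu>)"
    proof (rule nn_integral_mono)
      fix x
      have "emeasure \<nu> (ball x ?r) * indicator (W n) x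
          = (\<integral>\<^sup>+y. indicator {p. dist (fst p) (snd p) < ?r} (x, y) * indicator (W n) x \<partial>\<nu>)"
        by (subst nn_integral_multc) (auto simp: ind_\<nu>)
      also have "\<dots> \<le> (\<integral>\<^sup>+y. indicator {p. dist (fst p) (snd p) < ?r} (x, y) * indicator V y \<partial>\<nu>)"
        by (intro nn_integral_mono) (auto simp: W_def indicator_def)
      finally show "emeasure \<nu> (ball x ?r) * indicator (W n) x \<le> \<dots>" .
    qed
    also have "\<dots> = (\<integral>\<^sup>+y. \<integral>\<^sup>+x. indicator {p. dist (fst p) (snd p) < ?r} (x, y) * indicator V y \<partial>\<mu> \<partial>\<nu>)"
      by (rule P.Fubini'[symmetric]) measurable
    also have "\<dots> = (\<integral>\<^sup>+y. emeasure \<mu> (ball y ?r) * indicator V y \<partial>\<nu>)"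
      by (subst nn_integral_multc) (auto simp: ind_\<mu>)
    also have "\<dots> = (\<integral>\<^sup>+y. ?h * indicator V y \<partial>\<nu>)"
      using S(2) by (intro nn_integral_cong_AE) (erule eventually_mono, subst ball_\<mu>[OF _ x0], assumption, simp add: same)
    also have "\<dots> = ?h * emeasure \<nu> V"
      by (subst nn_integral_cmult_indicator) auto
    finally show ?thesis
      using pos[of ?r] \<nu>.emeasure_finite[of "ball x0 ?r"] by (simp add: ennreal_mult_le_mult_iff)
  qed
  moreover have "emeasure \<mu> V = (SUP n. emeasure \<mu> (W n))"
    using SUP_emeasure_incseq[of W \<mu>] W_inc W_Un by (auto simp: image_subset_iff)
  ultimately show ?thesis
    by (simp add: SUP_least)
qed

lemma uniformly_distributed_unique:
  fixes \<mu> \<nu> :: "'a::{metric_space,second_countable_topology} measure"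
  assumes "prob_space \<mu>" "prob_space \<nu>" "sets \<mu> = sets borel" "sets \<nu> = sets borel"
    and "AE x in \<mu>. x \<in> S" "AE x in \<nu>. x \<in> S"
    and "\<And>x y r. x \<in> S \<Longrightarrow> y \<in> S \<Longrightarrow> emeasure \<mu> (ball x r) = emeasure \<mu> (ball y r)"
    and "\<And>x y r. x \<in> S \<Longrightarrow> y \<in> S \<Longrightarrow> emeasure \<nu> (ball x r) = emeasure \<nu> (ball y r)"
  shows "\<mu> = \<nu>"
proof (rule measure_eqI_generator_eq[where E="{V. open V}" and \<Omega>=UNIV and A="\<lambda>_. UNIV"])
  show "emeasure \<mu> V = emeasure \<nu> V" if "V \<in> {V. open V}" for V
    using that emeasure_open_le_of_uniformly_distributed[OF assms(1-8)]
      emeasure_open_le_of_uniformly_distributed[OF assms(2,1,4,3,6,5,8,7)]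
    by (intro antisym) simp_all
  show "emeasure \<mu> UNIV \<noteq> \<infinity>"
    using assms(1) by (simp add: finite_measure.emeasure_finite prob_space.finite_measure)
qed (use assms(3,4) in \<open>auto simp: Int_stable_def borel_def\<close>)

text \<open>A rotation taking \<open>x\<close> to \<open>y\<close> is an isometry and pulls the ball
  around \<open>y\<close> back to the ball around \<open>x\<close>, so invariance gives equal ball
  masses. Rotations have determinant 1; they act transitively on the sphere from dimension two on,
  whereas in dimension one the two points are not exchanged.\<close>

lemma rotation_invariant_prob_sphere_unique:
  fixes \<mu> \<nu> :: "(real^'n) measure"
  assumes card: "2 \<le> CARD('n)"
    and "prob_space \<mu>" "prob_space \<nu>" "sets \<mu> = sets borel" "sets \<nu> = sets borel"
    and "AE x in \<mu>. x \<in> sphere 0 1" "AE x in \<nu>. x \<in> sphere 0 1"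
    and inv_\<mu>: "\<And>Q. rotation_matrix Q \<Longrightarrow> distr \<mu> borel ((*v) Q) = \<mu>"
    and inv_\<nu>: "\<And>Q. rotation_matrix Q \<Longrightarrow> distr \<nu> borel ((*v) Q) = \<nu>"
  shows "\<mu> = \<nu>"
proof -
  have ball: "emeasure M (ball x r) = emeasure M (ball y r)"
    if inv: "\<And>Q. rotation_matrix Q \<Longrightarrow> distr M borel ((*v) Q) = M"
      and xy: "x \<in> sphere 0 1" "y \<in> sphere 0 1"
      and M: "sets M = sets borel" for M :: "(real^'n) measure" and x y r
  proof -
    obtain f where f: "orthogonal_transformation f" "det (matrix f) = 1" "f x = y"
      using rotation_exists[OF card, of x y] xy by auto
    have lin: "linear f"
      using f(1) orthogonal_transformation_linear by blast
    have Q: "rotation_matrix (matrix f)"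
      using f(1,2) by (simp add: rotation_matrix_def orthogonal_transformation_matrix)
    have fQ: "(*v) (matrix f) = f"
      by (rule matrix_vector_mul(2)[OF lin])
    have [measurable]: "f \<in> borel_measurable M"
      unfolding measurable_cong_sets[OF M refl]
      using lin by (intro borel_measurable_continuous_onI linear_continuous_on) (simp add: linear_conv_bounded_linear)
    have "emeasure M (ball y r) = emeasure (distr M borel f) (ball y r)"
      using inv[OF Q] by (simp add: fQ)
    also have "\<dots> = emeasure M (f -` ball y r \<inter> space M)"
      by (rule emeasure_distr) auto
    also have "f -` ball y r \<inter> space M = ball x r"
      using sets_eq_imp_space_eq[OF M] f(1)
      by (auto simp: f(3)[symmetric] orthogonal_transformation_isometry)
    finally show ?thesis ..
  qed
  show ?thesis
    by (rule uniformly_distributed_unique[where S="sphere 0 1"]) (use assms ball in blast)+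
qed

subsection \<open>One-dimensional Hausdorff measure of circular arcs\<close>

lemma hausdorff1_mono: "A \<subseteq> B \<Longrightarrow> hausdorff1 A \<le> hausdorff1 B"
  unfolding hausdorff1_def hausdorff1_pre_def by (intro SUP_mono' INF_superset_mono) auto

text \<open>Outer regularity encloses \<open>T\<close> in an open set of nearly the same length.
  Short nonoverlapping intervals inside this set cover \<open>T\<close>, and the image of the part
  of \<open>T\<close> in each has diameter at most \<open>L\<close> times the length of the
  interval.\<close>

lemma hausdorff1_lipschitz_image_le:
  fixes f :: "real \<Rightarrow> 'a::real_normed_vector"
  assumes T: "T \<in> sets borel" "bounded T" and "0 \<le> L"
    and lip: "\<And>x y. x \<in> T \<Longrightarrow> y \<in> T \<Longrightarrow> dist (f x) (f y) \<le> L * \<bar>x - y\<bar>"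
  shows "hausdorff1 (f ` T) \<le> ennreal L * emeasure lborel T"
  unfolding hausdorff1_def
proof (rule SUP_least)
  fix \<delta> :: real assume "\<delta> \<in> {0<..}"
  then have \<delta>: "\<delta> > 0" by simp
  show "hausdorff1_pre \<delta> (f ` T) \<le> ennreal L * emeasure lborel T"
  proof (rule ennreal_le_epsilon)
    fix e :: real assume e: "e > 0"
    \<comment> \<open>The summand 1 covers the case \<open>L = 0\<close> and still gives
      \<open>L * e' \<le> e\<close>; it serves the same purpose in \<open>\<eta>\<close>
      below.\<close>
    define e' where "e' = e / (L + 1)"
    have e': "e' > 0"
      using e \<open>0 \<le> L\<close> by (simp add: e'_def)
    from outer_regular_lborel[OF T(1) e'] obtain G
      where G: "open G" "T \<subseteq> G" "emeasure lborel (G - T) < ennreal e'"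
      by blast
    have "emeasure lborel G = emeasure lborel T + emeasure lborel (G - T)"
      using plus_emeasure[of T lborel "G - T"] T G by (simp add: Un_absorb1)
    then have emG: "emeasure lborel G \<le> emeasure lborel T + ennreal e'"
      using G(3) by (simp add: add_left_mono less_imp_le)
    define \<eta> where "\<eta> = \<delta> / (2 * (L + 1))"
    have \<eta>: "\<eta> > 0" "L * (2 * \<eta>) \<le> \<delta>"
      using \<delta> \<open>0 \<le> L\<close> by (auto simp: \<eta>_def field_simps)
    obtain u where u: "T \<subseteq> cbox (- u) u"
      using bounded_subset_cbox_symmetric[OF T(2)] by blast
    have "T \<subseteq> cbox (- (\<bar>u\<bar> + 1)) (\<bar>u\<bar> + 1)" "box (- (\<bar>u\<bar> + 1)) (\<bar>u\<bar> + 1) \<noteq> {}"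
      using u by (auto simp: box_real)
    \<comment> \<open>The tags chosen by the covering lemma lie in \<open>T\<close>, hence in
      \<open>G\<close>, so only the first branch matters and it forces the intervals into
      \<open>G\<close>. The second branch just makes \<open>g\<close> a gauge everywhere.\<close>
    moreover define g where "g x = (if x \<in> G then ball x \<eta> \<inter> G else ball x \<eta>)" for x
    have "gauge g"
      using G(1) \<eta> by (auto simp: gauge_def g_def)
    ultimately obtain \<D> where D: "countable \<D>"
      "\<And>K. K \<in> \<D> \<Longrightarrow> interior K \<noteq> {} \<and> (\<exists>c d. K = cbox c d)"
      "pairwise (\<lambda>A B. interior A \<inter> interior B = {}) \<D>"
      "\<And>K. K \<in> \<D> \<Longrightarrow> \<exists>x \<in> T \<inter> K. K \<subseteq> g x" "T \<subseteq> \<Union>\<D>"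
      by (rule covering_lemma[of T "- (\<bar>u\<bar> + 1)" "\<bar>u\<bar> + 1" g]) blast
    have K_sub: "K \<subseteq> G" if K_in: "K \<in> \<D>" for K
    proof -
      obtain x where "x \<in> T" "K \<subseteq> g x"
        using D(4)[OF K_in] by blast
      moreover from this G(2) have "g x \<subseteq> G"
        by (auto simp: g_def)
      ultimately show ?thesis by blast
    qed
    have diam: "bounded (f ` (T \<inter> K)) \<and> diameter (f ` (T \<inter> K)) \<le> \<delta> \<and>
        ennreal (diameter (f ` (T \<inter> K))) \<le> ennreal L * emeasure lborel (interior K)" if K_in: "K \<in> \<D>" for K
    proof -
      obtain c d where K: "K = {c..d}" "c < d"
        using D(2)[OF K_in] by (auto simp: interior_cbox box_real)
      obtain x where x: "K \<subseteq> ball x \<eta>"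
        using D(4)[OF K_in] by (auto simp: g_def split: if_splits)
      have "c \<in> ball x \<eta>" "d \<in> ball x \<eta>"
        using subsetD[OF x, of c] subsetD[OF x, of d] K by auto
      then have len: "d - c \<le> 2 * \<eta>"
        by (auto simp: dist_real_def)
      have d: "dist p q \<le> L * (d - c)" if pq: "p \<in> f ` (T \<inter> K)" "q \<in> f ` (T \<inter> K)" for p q
      proof -
        obtain y z where yz: "p = f y" "q = f z" "y \<in> T \<inter> K" "z \<in> T \<inter> K"
          using pq by blast
        then have "\<bar>y - z\<bar> \<le> d - c"
          using K by auto
        then have "L * \<bar>y - z\<bar> \<le> L * (d - c)"
          using \<open>0 \<le> L\<close> by (rule mult_left_mono)
        then show ?thesis
          using lip[of y z] yz by auto
      qed
      have le: "diameter (f ` (T \<inter> K)) \<le> L * (d - c)"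
        by (rule diameter_le) (use d \<open>0 \<le> L\<close> K in \<open>auto simp: dist_norm\<close>)
      moreover have "L * (d - c) \<le> \<delta>"
        using mult_left_mono[OF len \<open>0 \<le> L\<close>] \<eta>(2) by linarith
      moreover have "bounded (f ` (T \<inter> K))"
        unfolding bounded_two_points using d by blast
      moreover have "ennreal (L * (d - c)) = ennreal L * emeasure lborel (interior K)"
        using K \<open>0 \<le> L\<close> by (simp add: ennreal_mult)
      ultimately show ?thesis
        using ennreal_leI[OF le] by auto
    qed
    \<comment> \<open>A sequence is required even when the family is finite: indices that code no
      interval receive the empty set, which contributes diameter 0.\<close>
    define K where "K n = (if n \<in> to_nat_on \<D> ` \<D> then from_nat_into \<D> n else {})" for n
    have K_cases: "K n = {} \<or> K n \<in> \<D>" for n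
      using D(1) by (auto simp: K_def)
    have K_Un: "\<Union>\<D> \<subseteq> (\<Union>n. K n)"
    proof
      fix x assume "x \<in> \<Union>\<D>"
      then obtain A where "A \<in> \<D>" "x \<in> A" by blast
      then have "x \<in> K (to_nat_on \<D> A)"
        using D(1) by (simp add: K_def)
      then show "x \<in> (\<Union>n. K n)" by blast
    qed
    \<comment> \<open>Neighbouring closed intervals may share endpoints. Passing to interiors makes
      lengths additive without changing them.\<close>
    have disj: "disjoint_family (\<lambda>n. interior (K n))"
      unfolding disjoint_family_on_def
    proof (intro ballI impI)
      fix m n :: nat assume "m \<noteq> n"
      show "interior (K m) \<inter> interior (K n) = {}"
      proof (cases "m \<in> to_nat_on \<D> ` \<D> \<and> n \<in> to_nat_on \<D> ` \<D>")
        case True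
        then obtain A B where AB: "A \<in> \<D>" "B \<in> \<D>" "m = to_nat_on \<D> A" "n = to_nat_on \<D> B"
          by blast
        then have "K m = A" "K n = B" "A \<noteq> B"
          using D(1) \<open>m \<noteq> n\<close> by (auto simp: K_def)
        then show ?thesis
          using D(3) AB by (simp add: pairwise_def)
      qed (auto simp: K_def)
    qed
    have diam': "bounded (f ` (T \<inter> K n)) \<and> diameter (f ` (T \<inter> K n)) \<le> \<delta> \<and>
        ennreal (diameter (f ` (T \<inter> K n))) \<le> ennreal L * emeasure lborel (interior (K n))" for n
      using K_cases[of n] diam[of "K n"] \<delta> by auto
    have "hausdorff1_pre \<delta> (f ` T) \<le> (\<Sum>n. ennreal (diameter (f ` (T \<inter> K n))))"
      unfolding hausdorff1_pre_def
    proof (rule INF_lower, safe)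
      fix x assume "x \<in> T"
      then show "f x \<in> (\<Union>n. f ` (T \<inter> K n))"
        using D(5) K_Un by blast
    qed (use diam' in auto)
    also have "\<dots> \<le> (\<Sum>n. ennreal L * emeasure lborel (interior (K n)))"
      using diam' by (intro suminf_le) auto
    also have "\<dots> = ennreal L * (\<Sum>n. emeasure lborel (interior (K n)))"
      by (rule ennreal_suminf_cmult)
    also have "(\<Sum>n. emeasure lborel (interior (K n))) = emeasure lborel (\<Union>n. interior (K n))"
      using disj by (intro suminf_emeasure) auto
    also have "\<dots> \<le> emeasure lborel G"
    proof (rule emeasure_mono)
      show "(\<Union>n. interior (K n)) \<subseteq> G"
        using K_cases K_sub interior_subset by fastforce
    qed (use G in auto)
    also have "\<dots> \<le> emeasure lborel T + ennreal e'"
      by (rule emG)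
    also have "ennreal L * (emeasure lborel T + ennreal e') = ennreal L * emeasure lborel T + ennreal (L * e')"
      using \<open>0 \<le> L\<close> e' by (simp add: distrib_left ennreal_mult)
    also have "ennreal (L * e') \<le> ennreal e"
      using \<open>0 \<le> L\<close> e by (intro ennreal_leI) (simp add: e'_def field_simps)
    finally show "hausdorff1_pre \<delta> (f ` T) \<le> ennreal L * emeasure lborel T + ennreal e"
      by (simp add: mult_left_mono add_left_mono)
  qed
qed

text \<open>The preimage in \<open>T\<close> of a covering set lies in an interval of length at most
  its diameter divided by \<open>c\<close>, so any cover of the image induces a cover of
  \<open>T\<close> by intervals. Expansion is demanded only for image points within \<delta>,
  because two points in one set of a \<delta>-cover are that close; a circle satisfies it only in
  this local form.\<close>

lemma emeasure_le_hausdorff1_image: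
  fixes f :: "real \<Rightarrow> 'a::metric_space"
  assumes T: "T \<in> sets borel" and "0 < \<delta>" "0 \<le> c"
    and expand: "\<And>x y. x \<in> T \<Longrightarrow> y \<in> T \<Longrightarrow> dist (f x) (f y) \<le> \<delta> \<Longrightarrow> c * \<bar>x - y\<bar> \<le> dist (f x) (f y)"
  shows "ennreal c * emeasure lborel T \<le> hausdorff1 (f ` T)"
proof (cases "c = 0")
  case False
  then have c: "c > 0" using \<open>0 \<le> c\<close> by simp
  have "ennreal c * emeasure lborel T \<le> hausdorff1_pre \<delta> (f ` T)"
    unfolding hausdorff1_pre_def
  proof (rule INF_greatest)
    fix E assume "E \<in> {E :: nat \<Rightarrow> 'a set. f ` T \<subseteq> (\<Union>i. E i) \<and> (\<forall>i. bounded (E i) \<and> diameter (E i) \<le> \<delta>)}"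
    then have E: "f ` T \<subseteq> (\<Union>i. E i)" "\<And>i. bounded (E i)" "\<And>i. diameter (E i) \<le> \<delta>"
      by auto
    define A where "A i = {x \<in> T. f x \<in> E i}" for i
    have A_diff: "\<bar>x - y\<bar> \<le> diameter (E i) / c" if "x \<in> A i" "y \<in> A i" for x y i
    proof -
      have "dist (f x) (f y) \<le> diameter (E i)"
        using that E(2) by (intro diameter_bounded_bound) (auto simp: A_def)
      moreover from this have "c * \<bar>x - y\<bar> \<le> dist (f x) (f y)"
        using that E(3)[of i] by (intro expand) (auto simp: A_def)
      ultimately show ?thesis
        using c by (simp add: field_simps)
    qed
    have "\<exists>u v. A i \<subseteq> {u..v} \<and> ennreal c * emeasure lborel {u..v} \<le> ennreal (diameter (E i))" for i
    proof (cases "A i = {}")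
      case True
      \<comment> \<open>The interval from 1 to 0 is empty and has length 0.\<close>
      then show ?thesis by (intro exI[of _ 1] exI[of _ 0]) auto
    next
      case False
      have "bounded (A i)"
        unfolding bounded_two_points using A_diff by (auto simp: dist_real_def)
      then have bdd: "bdd_above (A i)" "bdd_below (A i)"
        by (auto simp: bounded_imp_bdd_above bounded_imp_bdd_below)
      have "Sup (A i) \<le> Inf (A i) + diameter (E i) / c"
      proof (rule cSup_least[OF False])
        fix x assume x: "x \<in> A i"
        have "x - diameter (E i) / c \<le> Inf (A i)"
        proof (rule cInf_greatest[OF False])
          fix y assume "y \<in> A i"
          then show "x - diameter (E i) / c \<le> y"
            using A_diff[OF x, of y] by linarith
        qed
        then show "x \<le> Inf (A i) + diameter (E i) / c" by linarith
      qed
      then have "c * (Sup (A i) - Inf (A i)) \<le> diameter (E i)"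
        using c by (simp add: field_simps)
      moreover have sub: "A i \<subseteq> {Inf (A i)..Sup (A i)}"
        using bdd by (auto intro: cInf_lower cSup_upper)
      moreover have "Inf (A i) \<le> Sup (A i)"
        using sub False by force
      ultimately have "ennreal c * emeasure lborel {Inf (A i)..Sup (A i)} \<le> ennreal (diameter (E i))"
        using c by (simp add: ennreal_mult[symmetric] ennreal_leI)
      with sub show ?thesis by blast
    qed
    then obtain u v where uv: "\<And>i. A i \<subseteq> {u i..v i}"
      "\<And>i. ennreal c * emeasure lborel {u i..v i} \<le> ennreal (diameter (E i))"
      by metis
    have "T \<subseteq> (\<Union>i. {u i..v i})"
      using E(1) uv(1) by (force simp: A_def)
    then have "emeasure lborel T \<le> emeasure lborel (\<Union>i. {u i..v i})"
      by (intro emeasure_mono) auto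
    also have "\<dots> \<le> (\<Sum>i. emeasure lborel {u i..v i})"
      by (intro emeasure_subadditive_countably) auto
    finally have "ennreal c * emeasure lborel T \<le> ennreal c * (\<Sum>i. emeasure lborel {u i..v i})"
      by (rule mult_left_mono) simp
    also have "\<dots> = (\<Sum>i. ennreal c * emeasure lborel {u i..v i})"
      by simp
    also have "\<dots> \<le> (\<Sum>i. ennreal (diameter (E i)))"
      using uv(2) by (intro suminf_le) auto
    finally show "ennreal c * emeasure lborel T \<le> (\<Sum>i. ennreal (diameter (E i)))" .
  qed
  also have "\<dots> \<le> hausdorff1 (f ` T)"
    unfolding hausdorff1_def using \<open>0 < \<delta>\<close> by (intro SUP_upper) auto
  finally show ?thesis .
qed simp

text \<open>The half angle form serves both estimates for arcs:
  \<open>\<bar>sin z\<bar> \<le> \<bar>z\<bar>\<close> for the upper one, the mean value theorem for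
  the lower one.\<close>

lemma dist_circle_points:
  fixes e1 e2 c :: "'a::real_inner"
  assumes "norm e1 = 1" "norm e2 = 1" "orthogonal e1 e2" "0 \<le> r"
  shows "dist (c + r *\<^sub>R (cos x *\<^sub>R e1 + sin x *\<^sub>R e2)) (c + r *\<^sub>R (cos y *\<^sub>R e1 + sin y *\<^sub>R e2))
    = 2 * r * \<bar>sin ((x - y) / 2)\<bar>"
proof -
  have e: "e1 \<bullet> e1 = 1" "e2 \<bullet> e2 = 1" "e1 \<bullet> e2 = 0" "e2 \<bullet> e1 = 0"
    using assms by (auto simp: norm_eq_1 orthogonal_def inner_commute)
  let ?w = "(cos x - cos y) *\<^sub>R e1 + (sin x - sin y) *\<^sub>R e2"
  have "(norm ?w)\<^sup>2 = (cos x - cos y)\<^sup>2 + (sin x - sin y)\<^sup>2"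
    unfolding power2_norm_eq_inner by (simp add: inner_add_left inner_add_right e power2_eq_square)
  also have "\<dots> = (sin x)\<^sup>2 + (cos x)\<^sup>2 + ((sin y)\<^sup>2 + (cos y)\<^sup>2) - 2 * (cos x * cos y + sin x * sin y)"
    by (simp add: power2_eq_square algebra_simps)
  also have "\<dots> = 2 - 2 * cos (x - y)"
    by (simp add: cos_diff)
  also have "\<dots> = (2 * \<bar>sin ((x - y) / 2)\<bar>)\<^sup>2"
    using cos_double_sin[of "(x - y) / 2", unfolded mult_2 field_sum_of_halves]
    by (simp add: power_mult_distrib)
  finally have "norm ?w = 2 * \<bar>sin ((x - y) / 2)\<bar>"
    by (rule power2_eq_imp_eq) auto
  moreover have "c + r *\<^sub>R (cos x *\<^sub>R e1 + sin x *\<^sub>R e2) - (c + r *\<^sub>R (cos y *\<^sub>R e1 + sin y *\<^sub>R e2)) = r *\<^sub>R ?w"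
    by (simp add: algebra_simps)
  ultimately show ?thesis
    using \<open>0 \<le> r\<close> by (simp add: dist_norm)
qed

lemma hausdorff1_circle_arc:
  fixes e1 e2 c :: "'a::real_inner"
  assumes e: "norm e1 = 1" "norm e2 = 1" "orthogonal e1 e2" and r: "0 < r"
    and T: "T \<in> sets borel" "T \<subseteq> {0..<2*pi}"
  shows "hausdorff1 ((\<lambda>\<theta>. c + r *\<^sub>R (cos \<theta> *\<^sub>R e1 + sin \<theta> *\<^sub>R e2)) ` T) = ennreal r * emeasure lborel T"
    (is "hausdorff1 (?f ` T) = _")
proof (rule antisym)
  have d: "dist (?f x) (?f y) = 2 * r * \<bar>sin ((x - y) / 2)\<bar>" for x y
    using dist_circle_points[OF e, of r c x y] r by simp
  show "hausdorff1 (?f ` T) \<le> ennreal r * emeasure lborel T"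
  proof (rule hausdorff1_lipschitz_image_le)
    show "dist (?f x) (?f y) \<le> r * \<bar>x - y\<bar>" for x y
      using abs_sin_x_le_abs_x[of "(x - y) / 2"] r unfolding d by simp
    show "bounded T"
      using T(2) by (rule bounded_subset[rotated]) (rule bounded_subset[OF bounded_closed_interval], rule atLeastLessThan_subseteq_atLeastAtMost_iff[THEN iffD2], auto)
  qed (use T r in auto)
  \<comment> \<open>Chords do not see the jump of the angle at \<open>0\<close>; away from it, the angle is locally
    Lipschitz in the chord with a constant tending to \<open>1 / r\<close>.\<close>
  define \<epsilon> where "\<epsilon> n = 1 / real (n + 2)" for n
  have \<epsilon>: "0 < \<epsilon> n" "\<epsilon> n < 1" for n
    by (auto simp: \<epsilon>_def)
  define A where "A n = T \<inter> {\<epsilon> n..2*pi - \<epsilon> n}" for n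
  have bound: "ennreal (r * cos (\<epsilon> n)) * emeasure lborel (A n) \<le> hausdorff1 (?f ` T)" for n
  proof -
    \<comment> \<open>The shift by 2 in \<open>\<epsilon>\<close> keeps it below 1, so that its sine
      and cosine are both positive.\<close>
    have pi: "\<epsilon> n < pi / 2"
      using \<epsilon>[of n] pi_gt3 by linarith
    have sin_pos: "0 < sin (\<epsilon> n)" and cos_pos: "0 < cos (\<epsilon> n)"
      using \<epsilon>[of n] pi by (auto intro!: sin_gt_zero cos_gt_zero)
    have "ennreal (r * cos (\<epsilon> n)) * emeasure lborel (A n) \<le> hausdorff1 (?f ` A n)"
    proof (rule emeasure_le_hausdorff1_image)
      show "A n \<in> sets borel" using T by (auto simp: A_def)
      show "0 < r * sin (\<epsilon> n)" "0 \<le> r * cos (\<epsilon> n)"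
        using r sin_pos cos_pos by auto
      fix x y assume xy: "x \<in> A n" "y \<in> A n" and le: "dist (?f x) (?f y) \<le> r * sin (\<epsilon> n)"
      \<comment> \<open>Half the angular gap; trimming both ends of the parameter interval gives
        \<open>z \<le> pi - \<epsilon> n\<close>.\<close>
      define z where "z = \<bar>x - y\<bar> / 2"
      have z: "0 \<le> z" "z \<le> pi - \<epsilon> n"
        using xy by (auto simp: A_def z_def)
      have sz: "sin z \<ge> 0"
        using z \<epsilon>[of n] by (intro sin_ge_zero) auto
      have dz: "dist (?f x) (?f y) = 2 * r * sin z"
      proof (cases "y \<le> x")
        case True
        then have "(x - y) / 2 = z" by (simp add: z_def)
        with sz show ?thesis unfolding d by simp
      next
        case False
        then have "(x - y) / 2 = - z" unfolding z_def by linarith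
        with sz show ?thesis unfolding d by simp
      qed
      have "2 * r * sin z \<le> r * sin (\<epsilon> n)"
        using le dz by simp
      then have "sin z < sin (\<epsilon> n)"
        using r sin_pos by simp
      \<comment> \<open>On the interval from \<open>\<epsilon> n\<close> to
        \<open>pi - \<epsilon> n\<close> the sine is at least \<open>sin (\<epsilon> n)\<close>. A
        short chord therefore forces a small angle, since the trimming rules out angles near
        \<open>pi\<close>.\<close>
      have "z < \<epsilon> n"
      proof (rule ccontr)
        assume "\<not> z < \<epsilon> n"
        have "sin (\<epsilon> n) \<le> sin z"
        proof (cases "z \<le> pi / 2")
          case True
          then show ?thesis
            using \<open>\<not> z < \<epsilon> n\<close> \<epsilon>[of n] by (intro sin_monotone_2pi_le) auto
        next
          case False
          then have "sin (\<epsilon> n) \<le> sin (pi - z)"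
            using z \<epsilon>[of n] by (intro sin_monotone_2pi_le) auto
          then show ?thesis by simp
        qed
        with \<open>sin z < sin (\<epsilon> n)\<close> show False by simp
      qed
      have "z * cos (\<epsilon> n) \<le> sin z"
      proof (cases "z = 0")
        case False
        then have "0 < z" using z by simp
        then obtain w where w: "0 < w" "w < z" "sin z - sin 0 = (z - 0) * cos w"
          using MVT2[of 0 z sin cos] by (auto intro: DERIV_sin)
        have "cos (\<epsilon> n) \<le> cos w"
          using w \<open>z < \<epsilon> n\<close> pi by (intro cos_monotone_0_pi_le) auto
        then show ?thesis
          using w \<open>0 < z\<close> by simp
      qed simp
      then have "2 * r * (z * cos (\<epsilon> n)) \<le> 2 * r * sin z"
        using r by simp
      then show "r * cos (\<epsilon> n) * \<bar>x - y\<bar> \<le> dist (?f x) (?f y)"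
        unfolding dz by (simp add: z_def mult_ac)
    qed
    also have "\<dots> \<le> hausdorff1 (?f ` T)"
      by (rule hausdorff1_mono) (auto simp: A_def)
    finally show ?thesis .
  qed
  have \<epsilon>_lim: "\<epsilon> \<longlonglongrightarrow> 0"
    unfolding \<epsilon>_def by (rule LIMSEQ_ignore_initial_segment[OF lim_1_over_n])
  have "(\<lambda>n. emeasure lborel (A n)) \<longlonglongrightarrow> emeasure lborel (\<Union>n. A n)"
  proof (rule Lim_emeasure_incseq)
    show "incseq A"
    proof (rule incseq_SucI)
      fix n
      have "\<epsilon> (Suc n) \<le> \<epsilon> n" by (simp add: \<epsilon>_def frac_le)
      then show "A n \<subseteq> A (Suc n)" by (auto simp: A_def)
    qed
  qed (use T in \<open>auto simp: A_def\<close>)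
  \<comment> \<open>The parameter range omits \<open>2*pi\<close>, so the trimmed sets miss only the
    angle 0 in the limit, which is a null set.\<close>
  also have "(\<Union>n. A n) = T - {0}"
  proof (intro equalityI subsetI)
    fix x assume x: "x \<in> T - {0}"
    then have "0 < min x (2 * pi - x)"
      using T(2) by auto
    with \<epsilon>_lim have "eventually (\<lambda>n. \<epsilon> n < min x (2 * pi - x)) sequentially"
      by (rule order_tendstoD)
    then obtain n where "\<epsilon> n < min x (2 * pi - x)"
      by (auto dest: eventually_happens)
    then have "x \<in> A n"
      using x by (auto simp: A_def)
    then show "x \<in> (\<Union>n. A n)" by blast
  next
    fix x assume "x \<in> (\<Union>n. A n)"
    then obtain n where "x \<in> A n" by blast
    then show "x \<in> T - {0}"
      using \<epsilon>(1)[of n] by (auto simp: A_def)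
  qed
  also have "emeasure lborel (T - {0}) = emeasure lborel T"
    using T by (intro emeasure_Diff_null_set) (auto simp: null_sets_def)
  finally have "(\<lambda>n. ennreal (r * cos (\<epsilon> n)) * emeasure lborel (A n)) \<longlonglongrightarrow> ennreal (r * cos 0) * emeasure lborel T"
    using r \<epsilon>_lim by (intro tendsto_mult_ennreal tendsto_ennrealI tendsto_intros) auto
  then show "ennreal r * emeasure lborel T \<le> hausdorff1 (?f ` T)"
    using bound by (intro LIMSEQ_le_const2[of _ "ennreal r * emeasure lborel T"]) auto
qed

subsection \<open>Archimedes coordinates on the sphere\<close>

text \<open>No orientation is imposed; later only the absolute value of the Jacobian enters.\<close>

definition orthonormal_frame :: "real^3 \<Rightarrow> real^3 \<Rightarrow> real^3 \<Rightarrow> bool" where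
  "orthonormal_frame a e1 e2 \<longleftrightarrow> a \<bullet> a = 1 \<and> e1 \<bullet> e1 = 1 \<and> e2 \<bullet> e2 = 1 \<and>
     a \<bullet> e1 = 0 \<and> a \<bullet> e2 = 0 \<and> e1 \<bullet> e2 = 0"

definition cylinder_point :: "real^3 \<Rightarrow> real^3 \<Rightarrow> real^3 \<Rightarrow> real \<Rightarrow> real \<Rightarrow> real^3" where
  "cylinder_point a e1 e2 s \<theta> = s *\<^sub>R a + sqrt (1 - s\<^sup>2) *\<^sub>R (cos \<theta> *\<^sub>R e1 + sin \<theta> *\<^sub>R e2)"

lemma orthonormal_frame_inner:
  assumes "orthonormal_frame a e1 e2"
  shows "a \<bullet> a = 1" "e1 \<bullet> e1 = 1" "e2 \<bullet> e2 = 1" "a \<bullet> e1 = 0" "a \<bullet> e2 = 0" "e1 \<bullet> e2 = 0"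
    "e1 \<bullet> a = 0" "e2 \<bullet> a = 0" "e2 \<bullet> e1 = 0"
  using assms by (auto simp: orthonormal_frame_def inner_commute)

text \<open>The matrix with rows \<open>a\<close>, \<open>e1\<close>, \<open>e2\<close> has its
  transpose as right inverse, hence also as left inverse; applied to \<open>y\<close> this is the
  expansion.\<close>

lemma orthonormal_frame_expand:
  assumes "orthonormal_frame a e1 e2"
  shows "y = (y \<bullet> a) *\<^sub>R a + (y \<bullet> e1) *\<^sub>R e1 + (y \<bullet> e2) *\<^sub>R e2"
proof -
  define A :: "real^3^3" where "A = vector [a, e1, e2]"
  have "A ** transpose A = mat 1"
    using orthonormal_frame_inner[OF assms]
    by (simp add: A_def vec_eq_iff forall_3 matrix_matrix_mult_def transpose_def mat_def sum_3 inner_vec_def)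
  then have "transpose A ** A = mat 1"
    by (simp add: matrix_left_right_inverse)
  then have "transpose A *v (A *v y) = y"
    by (simp add: matrix_vector_mul_assoc)
  then show ?thesis
    by (simp add: A_def vec_eq_iff forall_3 matrix_vector_mult_def transpose_def sum_3 inner_vec_def mult_ac)
qed

lemma cylinder_point_inner:
  assumes "orthonormal_frame a e1 e2"
  shows "cylinder_point a e1 e2 s \<theta> \<bullet> a = s"
    "cylinder_point a e1 e2 s \<theta> \<bullet> e1 = sqrt (1 - s\<^sup>2) * cos \<theta>"
    "cylinder_point a e1 e2 s \<theta> \<bullet> e2 = sqrt (1 - s\<^sup>2) * sin \<theta>"
  using orthonormal_frame_inner[OF assms]
  by (simp_all add: cylinder_point_def inner_add_left)

lemma norm_cylinder_point:
  assumes "orthonormal_frame a e1 e2" "s\<^sup>2 \<le> 1"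
  shows "norm (cylinder_point a e1 e2 s \<theta>) = 1"
proof -
  define q where "q = sqrt (1 - s\<^sup>2)"
  have "cylinder_point a e1 e2 s \<theta> \<bullet> cylinder_point a e1 e2 s \<theta>
      = cylinder_point a e1 e2 s \<theta> \<bullet> (s *\<^sub>R a + q *\<^sub>R (cos \<theta> *\<^sub>R e1 + sin \<theta> *\<^sub>R e2))"
    by (simp add: cylinder_point_def q_def)
  also have "\<dots> = s * s + q * (cos \<theta> * (q * cos \<theta>) + sin \<theta> * (q * sin \<theta>))"
    by (simp only: inner_add_right inner_scaleR_right cylinder_point_inner[OF assms(1)] q_def)
  also have "\<dots> = s\<^sup>2 + q\<^sup>2 * ((sin \<theta>)\<^sup>2 + (cos \<theta>)\<^sup>2)"
    unfolding power2_eq_square by algebra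
  also have "\<dots> = 1"
    using assms(2) by (simp add: q_def)
  finally show ?thesis
    by (simp add: norm_eq_1)
qed

text \<open>The strict bound on the height excludes the poles, so the component orthogonal to
  \<open>a\<close> has positive length and can be normalized to a point of the unit circle.\<close>

lemma cylinder_point_exists:
  assumes "orthonormal_frame a e1 e2" "norm u = 1" "(u \<bullet> a)\<^sup>2 < 1"
  obtains \<theta> where "0 \<le> \<theta>" "\<theta> < 2 * pi" "u = cylinder_point a e1 e2 (u \<bullet> a) \<theta>"
proof -
  note i = orthonormal_frame_inner[OF assms(1)]
  define q where "q = sqrt (1 - (u \<bullet> a)\<^sup>2)"
  have q: "q > 0" "q\<^sup>2 = 1 - (u \<bullet> a)\<^sup>2"
    using assms(3) by (auto simp: q_def)
  note u = orthonormal_frame_expand[OF assms(1), of u]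
  have "u \<bullet> u = (u \<bullet> a)\<^sup>2 + (u \<bullet> e1)\<^sup>2 + (u \<bullet> e2)\<^sup>2"
    by (subst (2) u) (simp add: inner_add_right power2_eq_square)
  then have "(u \<bullet> e1)\<^sup>2 + (u \<bullet> e2)\<^sup>2 = q\<^sup>2"
    using assms(2) q by (simp add: norm_eq_1)
  then have "((u \<bullet> e1) / q)\<^sup>2 + ((u \<bullet> e2) / q)\<^sup>2 = 1"
    using q(1) by (simp add: power_divide add_divide_distrib[symmetric])
  then obtain t where t: "0 \<le> t" "t < 2 * pi" "(u \<bullet> e1) / q = cos t" "(u \<bullet> e2) / q = sin t"
    by (rule sincos_total_2pi)
  then have "u \<bullet> e1 = q * cos t" "u \<bullet> e2 = q * sin t"
    using q(1) by (auto simp: field_simps)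
  with u have "u = (u \<bullet> a) *\<^sub>R a + q *\<^sub>R (cos t *\<^sub>R e1 + sin t *\<^sub>R e2)"
    by (simp add: scaleR_add_right add.assoc)
  then show thesis
    using t by (intro that[of t]) (auto simp: cylinder_point_def q_def)
qed

lemma continuous_on_cylinder_point:
  "continuous_on UNIV (\<lambda>p. cylinder_point a e1 e2 (fst p) (snd p))"
  unfolding cylinder_point_def by (intro continuous_intros)

lemma measurable_cylinder_point [measurable]:
  assumes [measurable]: "f \<in> borel_measurable M" "g \<in> borel_measurable M"
  shows "(\<lambda>x. cylinder_point a e1 e2 (f x) (g x)) \<in> borel_measurable M"
proof -
  have "(\<lambda>x. (\<lambda>p. cylinder_point a e1 e2 (fst p) (snd p)) (f x, g x)) \<in> borel_measurable M"
    by (rule measurable_compose[OF _ borel_measurable_continuous_onI[OF continuous_on_cylinder_point]]) measurable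
  then show ?thesis by simp
qed

section \<open>Spherical coordinates and the volume of cones\<close>

lemma measurable_vec_nth [measurable]: "(\<lambda>x::real^'n. x $ i) \<in> borel_measurable borel"
  by (intro borel_measurable_continuous_onI continuous_intros)

lemma measurable_vector_3 [measurable]:
  assumes [measurable]: "f \<in> borel_measurable M" "g \<in> borel_measurable M" "h \<in> borel_measurable M"
  shows "(\<lambda>x. vector [f x, g x, h x] :: real^3) \<in> borel_measurable M"
  by (subst borel_measurable_euclidean_space)
    (auto simp: Basis_vec_def inner_axis UNIV_3)

text \<open>This splits the integral of the Jacobian into a radial factor and a cylinder factor.
  Both sides are compared on boxes, which determine Lebesgue measure.\<close>

lemma lborel_real3:
  "(lborel :: (real^3) measure)
    = distr (lborel \<Otimes>\<^sub>M (lborel \<Otimes>\<^sub>M lborel)) borel (\<lambda>p. vector [fst p, fst (snd p), snd (snd p)])"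
    (is "_ = distr ?P _ ?f")
proof (rule lborel_eqI)
  fix l u :: "real^3" assume le: "\<And>b. b \<in> Basis \<Longrightarrow> l \<bullet> b \<le> u \<bullet> b"
  have le': "l $ i \<le> u $ i" for i
    using le[of "axis i 1"] by (simp add: inner_axis)
  have sf: "sigma_finite_measure (lborel \<Otimes>\<^sub>M lborel :: (real \<times> real) measure)"
    unfolding lborel_prod by (rule sigma_finite_lborel)
  have [measurable]: "?f \<in> borel_measurable ?P"
    by measurable
  have "emeasure (distr ?P borel ?f) (box l u) = emeasure ?P (?f -` box l u \<inter> space ?P)"
    by (rule emeasure_distr) auto
  also have "?f -` box l u \<inter> space ?P
      = {l$1<..<u$1} \<times> ({l$2<..<u$2} \<times> {l$3<..<u$3})"
    by (auto simp: space_pair_measure mem_box_cart forall_3)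
  also have "emeasure ?P \<dots> = ennreal (u$1 - l$1) * (ennreal (u$2 - l$2) * ennreal (u$3 - l$3))"
    using le' by (simp add: sigma_finite_measure.emeasure_pair_measure_Times[OF sf] lborel.emeasure_pair_measure_Times)
  also have "\<dots> = ennreal ((u$1 - l$1) * ((u$2 - l$2) * (u$3 - l$3)))"
    using le' by (simp add: ennreal_mult)
  also have "(u$1 - l$1) * ((u$2 - l$2) * (u$3 - l$3)) = (\<Prod>i\<in>UNIV. (u - l) $ i)"
    unfolding UNIV_3 by simp
  also have "(\<Prod>i\<in>UNIV. (u - l) $ i) = (\<Prod>b\<in>Basis. (u - l) \<bullet> b)"
  proof -
    have B: "(Basis :: (real^3) set) = range (\<lambda>i. axis i 1)"
      by (auto simp: Basis_vec_def)
    show ?thesis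
      unfolding B by (subst prod.reindex) (auto simp: inj_on_def axis_eq_axis inner_axis)
  qed
  finally show "emeasure (distr ?P borel ?f) (box l u) = ennreal (\<Prod>b\<in>Basis. (u - l) \<bullet> b)" .
qed simp

text \<open>Gram determinant. The columns of the Jacobian are expressed in an arbitrary frame of
  which only inner products are known, so the determinant is reached through its square, at the
  price of its sign.\<close>

lemma det_matrix_squared:
  "(det (matrix f :: real^'n^'n))\<^sup>2 = det (\<chi> i j. f (axis i 1) \<bullet> f (axis j 1))"
proof -
  have "transpose (matrix f) ** matrix f = (\<chi> i j. f (axis i 1) \<bullet> f (axis j 1))"
    by (simp add: vec_eq_iff matrix_matrix_mult_def transpose_def matrix_def inner_vec_def)
  then show ?thesis
    by (metis det_mul det_transpose power2_eq_square)
qed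

text \<open>The components of \<open>x\<close> are radius, height and angle. The height stays
  strictly between -1 and 1 because the square root is not differentiable at the poles.\<close>

lemma has_derivative_spherical:
  fixes x :: "real^3"
  assumes s: "(x$2)\<^sup>2 < 1"
  shows "((\<lambda>x. x$1 *\<^sub>R cylinder_point a e1 e2 (x$2) (x$3)) has_derivative
    (\<lambda>h. h$1 *\<^sub>R cylinder_point a e1 e2 (x$2) (x$3)
      + h$2 *\<^sub>R (x$1 *\<^sub>R (a - (x$2 / sqrt (1 - (x$2)\<^sup>2)) *\<^sub>R (cos (x$3) *\<^sub>R e1 + sin (x$3) *\<^sub>R e2)))
      + h$3 *\<^sub>R (x$1 *\<^sub>R (sqrt (1 - (x$2)\<^sup>2) *\<^sub>R (cos (x$3) *\<^sub>R e2 - sin (x$3) *\<^sub>R e1))))) (at x within S)"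
proof -
  note [derivative_intros] = bounded_linear.has_derivative[OF bounded_linear_vec_nth]
  have q: "0 < 1 - (x$2)\<^sup>2" "0 < sqrt (1 - (x$2)\<^sup>2)"
    using s by auto
  show ?thesis
    unfolding cylinder_point_def
    apply (rule derivative_eq_intros refl q | simp)+
    apply (rule ext)
    using q by (simp add: algebra_simps divide_inverse)
qed

text \<open>The three partial derivatives are orthogonal, of lengths 1,
  \<open>\<bar>x$1\<bar> / q\<close> and \<open>\<bar>x$1\<bar> * q\<close>. The factors
  \<open>q\<close> cancel: shrinking of the parallels is compensated by the slope of the meridians,
  as in Archimedes' theorem.\<close>

lemma det_spherical:
  fixes x :: "real^3"
  assumes frame: "orthonormal_frame a e1 e2" and s: "(x$2)\<^sup>2 < 1"
  shows "\<bar>det (matrix (\<lambda>h::real^3. h$1 *\<^sub>R cylinder_point a e1 e2 (x$2) (x$3)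
      + h$2 *\<^sub>R (x$1 *\<^sub>R (a - (x$2 / sqrt (1 - (x$2)\<^sup>2)) *\<^sub>R (cos (x$3) *\<^sub>R e1 + sin (x$3) *\<^sub>R e2)))
      + h$3 *\<^sub>R (x$1 *\<^sub>R (sqrt (1 - (x$2)\<^sup>2) *\<^sub>R (cos (x$3) *\<^sub>R e2 - sin (x$3) *\<^sub>R e1)))))\<bar> = (x$1)\<^sup>2"
    (is "\<bar>det (matrix ?f)\<bar> = _")
proof -
  note i = orthonormal_frame_inner[OF frame]
  define q where "q = sqrt (1 - (x$2)\<^sup>2)"
  have q: "q > 0" "q * q = 1 - x$2 * x$2"
    using s by (auto simp: q_def power2_eq_square)
  define c where "c = cos (x$3) *\<^sub>R e1 + sin (x$3) *\<^sub>R e2"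
  define c' where "c' = cos (x$3) *\<^sub>R e2 - sin (x$3) *\<^sub>R e1"
  have c: "c \<bullet> c = 1" "c' \<bullet> c' = 1" "c \<bullet> c' = 0" "c' \<bullet> c = 0" "a \<bullet> c = 0" "c \<bullet> a = 0" "a \<bullet> c' = 0" "c' \<bullet> a = 0"
    using sin_cos_squared_add3[of "x$3"] 
    by (simp_all add: c_def c'_def inner_add_left inner_add_right inner_diff_left inner_diff_right i)
  define v1 where "v1 = x$2 *\<^sub>R a + q *\<^sub>R c"
  define v2 where "v2 = x$1 *\<^sub>R (a - (x$2 / q) *\<^sub>R c)"
  define v3 where "v3 = x$1 *\<^sub>R (q *\<^sub>R c')"
  have f: "?f = (\<lambda>h. h$1 *\<^sub>R v1 + h$2 *\<^sub>R v2 + h$3 *\<^sub>R v3)"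
    by (simp add: v1_def v2_def v3_def c_def c'_def q_def cylinder_point_def)
  have v: "v1 \<bullet> v1 = 1" "v1 \<bullet> v2 = 0" "v1 \<bullet> v3 = 0" "v2 \<bullet> v1 = 0" "v2 \<bullet> v3 = 0" "v3 \<bullet> v1 = 0" "v3 \<bullet> v2 = 0"
    "v3 \<bullet> v3 = (x$1 * q)\<^sup>2"
    using q by (simp_all add: v1_def v2_def v3_def inner_add_left inner_add_right inner_diff_left inner_diff_right c i
        power2_eq_square field_simps)
  have "v2 \<bullet> v2 = (x$1)\<^sup>2 * ((q\<^sup>2 + (x$2)\<^sup>2) / q\<^sup>2)"
    using q(1) by (simp add: v2_def inner_diff_left inner_diff_right c i power2_eq_square field_simps)
  also have "q\<^sup>2 + (x$2)\<^sup>2 = 1"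
    using q(2) by (simp add: power2_eq_square)
  finally have v2: "v2 \<bullet> v2 = (x$1 / q)\<^sup>2"
    by (simp add: power_divide)
  have "(det (matrix ?f))\<^sup>2 = ((x$1)\<^sup>2)\<^sup>2"
    unfolding det_matrix_squared f using q
    by (simp add: det_3 v v2 axis_def power_divide power_mult_distrib)
  then show ?thesis
    unfolding power2_eq_iff by (elim disjE) (simp_all only: abs_minus_cancel abs_power2)
qed

text \<open>The Jacobian depends on the radius alone, so the volume is a product; the factor 1/3 is
  the integral of the squared radius from 0 to 1.\<close>

lemma emeasure_cone_cylinder:
  assumes frame: "orthonormal_frame a e1 e2" and [measurable]: "B \<in> sets borel"
  shows "emeasure lborel {y::real^3. y \<noteq> 0 \<and> norm y \<le> 1 \<and> y /\<^sub>R norm y \<in> B}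
    = ennreal (1/3) * emeasure (lborel \<Otimes>\<^sub>M lborel)
        {p \<in> {-1<..<1} \<times> {0<..<2*pi}. cylinder_point a e1 e2 (fst p) (snd p) \<in> B}"
    (is "emeasure lborel ?C = _ * emeasure _ ?P")
proof -
  note i = orthonormal_frame_inner[OF frame]
  let ?c = "cylinder_point a e1 e2"
  define \<Phi> where "\<Phi> x = x$1 *\<^sub>R ?c (x$2) (x$3)" for x :: "real^3"
  define E where "E = {x::real^3. 0 < x$1 \<and> x$1 \<le> 1 \<and> -1 < x$2 \<and> x$2 < 1 \<and> 0 < x$3 \<and> x$3 < 2*pi \<and> ?c (x$2) (x$3) \<in> B}"
  have E_borel [measurable]: "E \<in> sets borel"
    unfolding E_def by measurable
  have P_meas [measurable]: "?P \<in> sets (lborel \<Otimes>\<^sub>M lborel)"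
    by measurable
  have C_borel: "?C \<in> sets borel"
    by measurable
  have sq: "(x$2)\<^sup>2 < 1" if "x \<in> E" for x
    using that by (auto simp: E_def abs_square_less_1 abs_less_iff)
  define m where "m = measure (lborel \<Otimes>\<^sub>M lborel) ?P / 3"
  have em: "emeasure (lborel \<Otimes>\<^sub>M lborel) ?P = ennreal (measure (lborel \<Otimes>\<^sub>M lborel) ?P)"
  proof (rule emeasure_eq_ennreal_measure)
    have "emeasure (lborel \<Otimes>\<^sub>M lborel) ?P \<le> emeasure (lborel \<Otimes>\<^sub>M lborel) ({-1<..<1::real} \<times> {0<..<2*pi})"
      by (rule emeasure_mono) auto
    also have "\<dots> = ennreal 2 * ennreal (2 * pi)"
      by (subst lborel.emeasure_pair_measure_Times) auto
    also have "\<dots> < \<infinity>"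
      by (simp add: ennreal_mult_less_top)
    finally show "emeasure (lborel \<Otimes>\<^sub>M lborel) ?P \<noteq> top" by simp
  qed
  have sf: "sigma_finite_measure (lborel \<Otimes>\<^sub>M lborel :: (real \<times> real) measure)"
    unfolding lborel_prod by (rule sigma_finite_lborel)
  have sq_int: "(\<integral>\<^sup>+x. ennreal (x\<^sup>2) * indicator {0<..1} x \<partial>lborel) = ennreal (1/3)"
  proof -
    have "(\<integral>\<^sup>+x. ennreal (x\<^sup>2) * indicator {0<..1} x \<partial>lborel) = (\<integral>\<^sup>+x. ennreal (x\<^sup>2) * indicator {0..1} x \<partial>lborel)"
      by (intro nn_integral_cong) (auto simp: indicator_def)
    also have "\<dots> = ennreal (1^3/3 - 0^3/3)"
      by (rule nn_integral_FTC_Icc) (auto intro!: derivative_eq_intros)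
    finally show ?thesis by simp
  qed
  have "(\<integral>\<^sup>+x. ennreal ((x$1)\<^sup>2 * indicator E x) \<partial>lborel)
      = (\<integral>\<^sup>+p. ennreal ((fst p)\<^sup>2 * indicator E (vector [fst p, fst (snd p), snd (snd p)])) \<partial>(lborel \<Otimes>\<^sub>M (lborel \<Otimes>\<^sub>M lborel)))"
    by (subst lborel_real3, subst nn_integral_distr) auto
  also have "\<dots> = (\<integral>\<^sup>+p. (ennreal ((fst p)\<^sup>2) * indicator {0<..1} (fst p)) * indicator ?P (snd p) \<partial>(lborel \<Otimes>\<^sub>M (lborel \<Otimes>\<^sub>M lborel)))"
    by (intro nn_integral_cong) (auto simp: E_def indicator_def)
  also have "\<dots> = (\<integral>\<^sup>+x. \<integral>\<^sup>+q. (ennreal (x\<^sup>2) * indicator {0<..1} x) * indicator ?P q \<partial>(lborel \<Otimes>\<^sub>M lborel) \<partial>lborel)"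
    by (subst sigma_finite_measure.nn_integral_fst[OF sf, symmetric]) auto
  also have "\<dots> = (\<integral>\<^sup>+x. (ennreal (x\<^sup>2) * indicator {0<..1} x) * emeasure (lborel \<Otimes>\<^sub>M lborel) ?P \<partial>lborel)"
    by (subst nn_integral_cmult_indicator) auto
  also have "\<dots> = ennreal (1/3) * emeasure (lborel \<Otimes>\<^sub>M lborel) ?P"
    by (subst nn_integral_multc) (auto simp: sq_int)
  finally have "(\<integral>\<^sup>+x. ennreal ((x$1)\<^sup>2 * indicator E x) \<partial>lborel) = ennreal (1/3) * emeasure (lborel \<Otimes>\<^sub>M lborel) ?P" .
  \<comment> \<open>Finiteness turns the extended integral into a real one, the form taken by the
    change of variables theorem for \<open>\<Phi>\<close>.\<close>
  also have m: "\<dots> = ennreal m"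
    by (simp add: em m_def ennreal_mult[symmetric])
  finally have "((\<lambda>x. (x$1)\<^sup>2 * indicator E x) has_integral m) UNIV"
    by (intro nn_integral_has_integral) (auto simp: m_def)
  also have "(\<lambda>x. (x$1)\<^sup>2 * indicator E x) = (\<lambda>x. if x \<in> E then (x$1)\<^sup>2 else 0)"
    by (auto simp: indicator_def)
  finally have int: "((\<lambda>x. (x$1)\<^sup>2) has_integral m) E"
    by (simp add: has_integral_restrict_UNIV)
  have inj: "inj_on \<Phi> E"
  proof (rule inj_onI)
    fix x y assume xy: "x \<in> E" "y \<in> E" and eq: "\<Phi> x = \<Phi> y"
    have norm: "norm (\<Phi> z) = z$1" if "z \<in> E" for z
      using that sq[OF that] norm_cylinder_point[OF frame, of "z$2" "z$3"] by (simp add: \<Phi>_def E_def)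
    have 1: "x$1 = y$1"
      using norm xy eq by metis
    then have c: "?c (x$2) (x$3) = ?c (y$2) (y$3)"
      using eq xy by (simp add: \<Phi>_def E_def)
    then have 2: "x$2 = y$2"
      using cylinder_point_inner(1)[OF frame] by metis
    have "sqrt (1 - (x$2)\<^sup>2) \<noteq> 0"
      using sq[OF xy(1)] by simp
    then have "cos (x$3) = cos (y$3)" "sin (x$3) = sin (y$3)"
      using cylinder_point_inner(2,3)[OF frame, of "x$2" "x$3"] cylinder_point_inner(2,3)[OF frame, of "y$2" "y$3"] c 2
      by auto
    then obtain n :: int where n: "x$3 = y$3 + 2 * pi * n"
      using sin_cos_eq_iff by metis
    have "\<bar>x$3 - y$3\<bar> < 2 * pi"
      using xy by (auto simp: E_def)
    then have "2 * pi * \<bar>real_of_int n\<bar> < 2 * pi * 1"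
      by (simp add: n abs_mult)
    then have "\<bar>real_of_int n\<bar> < 1"
      by (subst (asm) mult_less_cancel_left_pos) auto
    then have "n = 0" by linarith
    with n 1 2 show "x = y"
      by (simp add: vec_eq_iff forall_3)
  qed
  have img: "\<Phi> ` E \<in> lmeasurable \<and> measure lebesgue (\<Phi> ` E) = m"
  proof -
    define \<Phi>' where "\<Phi>' x = (\<lambda>h::real^3. h$1 *\<^sub>R ?c (x$2) (x$3)
      + h$2 *\<^sub>R (x$1 *\<^sub>R (a - (x$2 / sqrt (1 - (x$2)\<^sup>2)) *\<^sub>R (cos (x$3) *\<^sub>R e1 + sin (x$3) *\<^sub>R e2)))
      + h$3 *\<^sub>R (x$1 *\<^sub>R (sqrt (1 - (x$2)\<^sup>2) *\<^sub>R (cos (x$3) *\<^sub>R e2 - sin (x$3) *\<^sub>R e1))))" for x :: "real^3"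
    have "E \<in> sets lebesgue"
      by simp
    moreover have "(\<Phi> has_derivative \<Phi>' x) (at x within E)" if "x \<in> E" for x
      unfolding \<Phi>_def[abs_def] \<Phi>'_def by (rule has_derivative_spherical[OF sq[OF that]])
    moreover have "((\<lambda>x. \<bar>det (matrix (\<Phi>' x))\<bar>) has_integral m) E"
      using int by (rule has_integral_eq[rotated]) (simp only: \<Phi>'_def det_spherical[OF frame sq])
    ultimately show ?thesis
      using has_measure_differentiable_image[OF _ _ inj] by blast
  qed
  have U: "?C = \<Phi> ` E \<union> (?C - \<Phi> ` E)"
  proof -
    have "\<Phi> x \<in> ?C" if "x \<in> E" for x
    proof -
      have "norm (?c (x$2) (x$3)) = 1"
        using sq[OF that] by (intro norm_cylinder_point[OF frame]) simp
      then show ?thesis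
        using that by (auto simp: \<Phi>_def E_def)
    qed
    then have "\<Phi> ` E \<subseteq> ?C"
      by (rule image_subsetI)
    then show ?thesis
      by (simp only: Un_Diff_cancel Un_absorb1)
  qed
  have null: "emeasure lebesgue (\<Phi> ` E \<union> (?C - \<Phi> ` E)) = emeasure lebesgue (\<Phi> ` E)"
  proof (rule emeasure_Un_null_set)
    show "\<Phi> ` E \<in> sets lebesgue"
      using img by (simp add: fmeasurableD)
    \<comment> \<open>The open parameter box, needed for injectivity, omits the poles and the half
      circle at angle 0. All these directions are orthogonal to \<open>e2\<close>, so the omitted
      points lie in one plane.\<close>
    have "?C - \<Phi> ` E \<subseteq> {y. e2 \<bullet> y = 0}"
    proof (rule subsetI, rule ccontr)
      fix y assume y: "y \<in> ?C - \<Phi> ` E" "y \<notin> {y. e2 \<bullet> y = 0}"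
      define u where "u = y /\<^sub>R norm y"
      have u: "norm u = 1" "y = norm y *\<^sub>R u" "u \<in> B" "u \<bullet> e2 \<noteq> 0"
        using y by (auto simp: u_def inner_commute)
      have "u \<bullet> u = (u \<bullet> a)\<^sup>2 + (u \<bullet> e1)\<^sup>2 + (u \<bullet> e2)\<^sup>2"
        using arg_cong[OF orthonormal_frame_expand[OF frame, of u], of "inner u"]
        by (simp add: inner_add_right power2_eq_square)
      moreover have "(u \<bullet> e2)\<^sup>2 > 0" "(u \<bullet> e1)\<^sup>2 \<ge> 0"
        using u by auto
      ultimately have lt: "(u \<bullet> a)\<^sup>2 < 1"
        using u(1) unfolding norm_eq_1 by linarith
      obtain \<theta> where \<theta>: "0 \<le> \<theta>" "\<theta> < 2 * pi" "u = ?c (u \<bullet> a) \<theta>"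
        by (rule cylinder_point_exists[OF frame u(1) lt])
      have "sin \<theta> \<noteq> 0"
        using cylinder_point_inner(3)[OF frame, of "u \<bullet> a" \<theta>] \<theta>(3) u(4) by auto
      then have "\<theta> \<noteq> 0" by auto
      have "-1 < u \<bullet> a" "u \<bullet> a < 1"
        using lt by (auto simp: abs_square_less_1 abs_less_iff)
      then have v: "vector [norm y, u \<bullet> a, \<theta>] \<in> E" "\<Phi> (vector [norm y, u \<bullet> a, \<theta>]) = y"
        using y u \<theta> \<open>\<theta> \<noteq> 0\<close> by (auto simp: E_def \<Phi>_def)
      have "y \<in> \<Phi> ` E"
        using v by (intro image_eqI[where f=\<Phi> and x="vector [norm y, u \<bullet> a, \<theta>]"]) (rule sym)
      then show False
        by (rule DiffD2[OF y(1)])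
    qed
    then have "negligible (?C - \<Phi> ` E)"
      by (rule negligible_subset[rotated]) (rule negligible_hyperplane, use i in auto)
    then show "?C - \<Phi> ` E \<in> null_sets lebesgue"
      by (simp add: negligible_iff_null_sets)
  qed
  have "emeasure lborel ?C = emeasure lebesgue ?C"
    using C_borel by (simp add: emeasure_completion)
  also have "\<dots> = emeasure lebesgue (\<Phi> ` E)"
    by (rule null[folded U])
  also have "emeasure lebesgue (\<Phi> ` E) = ennreal m"
    using img by (auto simp: emeasure_eq_measure2)
  finally show ?thesis
    using m by simp
qed

section \<open>The image of the uniform distribution on the cylinder\<close>

lemma orthonormal_frame_rotation:
  assumes "orthonormal_frame a e1 e2" "orthogonal_transformation f"
  shows "orthonormal_frame (f a) (f e1) (f e2)"
  using assms by (simp add: orthonormal_frame_def orthogonal_transformation_def)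

lemma cylinder_point_linear:
  assumes "linear f"
  shows "f (cylinder_point a e1 e2 s \<theta>) = cylinder_point (f a) (f e1) (f e2) s \<theta>"
proof -
  interpret linear f by fact
  show ?thesis by (simp add: cylinder_point_def add scale)
qed

lemma emeasure_cylinder:
  "emeasure (lborel \<Otimes>\<^sub>M lborel) ({-1<..<1::real} \<times> {0<..<2*pi}) = ennreal (4 * pi)"
proof -
  have "emeasure (lborel \<Otimes>\<^sub>M lborel) ({-1<..<1::real} \<times> {0<..<2*pi}) = ennreal 2 * ennreal (2 * pi)"
    by (subst lborel.emeasure_pair_measure_Times) auto
  then show ?thesis
    by (simp add: ennreal_mult[symmetric] del: ennreal_numeral)
qed

text \<open>A measure on all Borel sets of space that is carried by the sphere, which is the setting
  of the uniqueness lemma.\<close>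

definition cylinder_distr :: "real^3 \<Rightarrow> real^3 \<Rightarrow> real^3 \<Rightarrow> (real^3) measure" where
  "cylinder_distr a e1 e2 =
     distr (uniform_measure (lborel \<Otimes>\<^sub>M lborel) ({-1<..<1} \<times> {0<..<2*pi})) borel
       (\<lambda>p. cylinder_point a e1 e2 (fst p) (snd p))"

lemma measurable_cylinder_point_uniform:
  "(\<lambda>p. cylinder_point a e1 e2 (fst p) (snd p))
     \<in> borel_measurable (uniform_measure (lborel \<Otimes>\<^sub>M lborel) ({-1<..<1} \<times> {0<..<2*pi}))"
proof -
  have "(\<lambda>p. cylinder_point a e1 e2 (fst p) (snd p)) \<in> borel_measurable (lborel \<Otimes>\<^sub>M lborel)"
    by measurable
  then show ?thesis by simp
qed

lemma sets_cylinder_distr: "sets (cylinder_distr a e1 e2) = sets borel"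
  by (simp add: cylinder_distr_def)

lemma prob_space_cylinder_distr: "prob_space (cylinder_distr a e1 e2)"
  unfolding cylinder_distr_def
  by (intro prob_space.prob_space_distr prob_space_uniform_measure measurable_cylinder_point_uniform)
    (simp_all add: emeasure_cylinder)

lemma emeasure_cylinder_distr:
  assumes [measurable]: "B \<in> sets borel"
  shows "emeasure (cylinder_distr a e1 e2) B = ennreal (1 / (4 * pi)) * emeasure (lborel \<Otimes>\<^sub>M lborel)
    {p \<in> {-1<..<1} \<times> {0<..<2*pi}. cylinder_point a e1 e2 (fst p) (snd p) \<in> B}"
proof -
  let ?g = "\<lambda>p. cylinder_point a e1 e2 (fst p) (snd p)"
  let ?R = "{-1<..<1::real} \<times> {0<..<2*pi}"
  have g: "?g -` B \<in> sets (lborel \<Otimes>\<^sub>M lborel)"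
  proof -
    have "?g \<in> borel_measurable (lborel \<Otimes>\<^sub>M lborel)" by measurable
    from measurable_sets[OF this assms] show ?thesis by (simp add: space_pair_measure)
  qed
  have "emeasure (cylinder_distr a e1 e2) B = emeasure (uniform_measure (lborel \<Otimes>\<^sub>M lborel) ?R) (?g -` B)"
    unfolding cylinder_distr_def
    by (subst emeasure_distr[OF measurable_cylinder_point_uniform assms]) (simp add: space_pair_measure)
  also have "\<dots> = emeasure (lborel \<Otimes>\<^sub>M lborel) (?R \<inter> ?g -` B) / ennreal (4 * pi)"
    using g by (subst emeasure_uniform_measure) (auto simp: emeasure_cylinder)
  also have "\<dots> = ennreal (1 / (4 * pi)) * emeasure (lborel \<Otimes>\<^sub>M lborel) (?R \<inter> ?g -` B)"
    by (simp add: divide_ennreal_def inverse_ennreal mult.commute inverse_eq_divide)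
  also have "?R \<inter> ?g -` B = {p \<in> ?R. ?g p \<in> B}"
    by auto
  finally show ?thesis .
qed

lemma AE_cylinder_distr_sphere:
  assumes "orthonormal_frame a e1 e2"
  shows "AE x in cylinder_distr a e1 e2. x \<in> sphere 0 1"
  unfolding cylinder_distr_def
proof (subst AE_distr_iff[OF measurable_cylinder_point_uniform])
  show "AE p in uniform_measure (lborel \<Otimes>\<^sub>M lborel) ({-1<..<1} \<times> {0<..<2 * pi}).
      cylinder_point a e1 e2 (fst p) (snd p) \<in> sphere 0 1"
  proof (rule AE_uniform_measureI)
    have "norm (cylinder_point a e1 e2 s \<theta>) = 1" if "-1 < s" "s < 1" for s \<theta>
      using that by (intro norm_cylinder_point[OF assms]) (simp add: abs_square_le_1 abs_le_iff)
    then show "AE p in lborel \<Otimes>\<^sub>M lborel. p \<in> {-1<..<1} \<times> {0<..<2 * pi} \<longrightarrow>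
        cylinder_point a e1 e2 (fst p) (snd p) \<in> sphere 0 1"
      by auto
  qed auto
qed auto

text \<open>The cone measure on the right of \<open>emeasure_cone_cylinder\<close> does not mention the frame.\<close>

lemma cylinder_distr_frame_independent:
  assumes "orthonormal_frame a e1 e2" "orthonormal_frame a' e1' e2'"
  shows "cylinder_distr a e1 e2 = cylinder_distr a' e1' e2'"
proof (rule measure_eqI)
  fix B assume "B \<in> sets (cylinder_distr a e1 e2)"
  then have B: "B \<in> sets borel"
    by (simp add: sets_cylinder_distr)
  have "ennreal (1/3) * emeasure (lborel \<Otimes>\<^sub>M lborel)
        {p \<in> {-1<..<1} \<times> {0<..<2*pi}. cylinder_point a e1 e2 (fst p) (snd p) \<in> B}
      = ennreal (1/3) * emeasure (lborel \<Otimes>\<^sub>M lborel)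
        {p \<in> {-1<..<1} \<times> {0<..<2*pi}. cylinder_point a' e1' e2' (fst p) (snd p) \<in> B}"
    using emeasure_cone_cylinder[OF assms(1) B] emeasure_cone_cylinder[OF assms(2) B] by simp
  then show "emeasure (cylinder_distr a e1 e2) B = emeasure (cylinder_distr a' e1' e2') B"
    unfolding emeasure_cylinder_distr[OF B] by (subst (asm) ennreal_mult_cancel_left) auto
qed (simp add: sets_cylinder_distr)

text \<open>By linearity, rotating the image amounts to rotating the frame, so invariance reduces to
  independence of the frame.\<close>

lemma distr_cylinder_distr_rotation:
  assumes frame: "orthonormal_frame a e1 e2" and Q: "rotation_matrix Q"
  shows "distr (cylinder_distr a e1 e2) borel ((*v) Q) = cylinder_distr a e1 e2"
proof -
  have orth: "orthogonal_transformation ((*v) Q)"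
    using Q by (simp add: rotation_matrix_def orthogonal_transformation_matrix)
  have Q_meas: "(*v) Q \<in> borel_measurable borel"
    by (intro borel_measurable_continuous_onI matrix_vector_mult_linear_continuous_on)
  have "distr (cylinder_distr a e1 e2) borel ((*v) Q) = cylinder_distr (Q *v a) (Q *v e1) (Q *v e2)"
    unfolding cylinder_distr_def
    by (subst distr_distr[OF Q_meas measurable_cylinder_point_uniform])
      (simp add: o_def cylinder_point_linear[OF matrix_vector_mul_linear])
  also have "\<dots> = cylinder_distr a e1 e2"
    by (rule cylinder_distr_frame_independent[OF orthonormal_frame_rotation[OF frame orth] frame])
  finally show ?thesis .
qed

lemma emeasure_rotation_invariant_prob:
  assumes \<sigma>: "rotation_invariant_prob \<sigma>" and frame: "orthonormal_frame a e1 e2"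
    and B: "B \<in> sets borel" "B \<subseteq> sphere 0 1"
  shows "emeasure \<sigma> B = ennreal (1 / (4 * pi)) * emeasure (lborel \<Otimes>\<^sub>M lborel)
    {p \<in> {-1<..<1} \<times> {0<..<2*pi}. cylinder_point a e1 e2 (fst p) (snd p) \<in> B}"
proof -
  have prob: "prob_space \<sigma>" and sets_\<sigma>: "sets \<sigma> = sets (restrict_space borel (sphere 0 1))"
    and inv: "\<And>Q::real^3^3. rotation_matrix Q \<Longrightarrow> distr \<sigma> \<sigma> ((*v) Q) = \<sigma>"
    using \<sigma> by (auto simp: rotation_invariant_prob_def)
  have space_\<sigma>: "space \<sigma> = sphere 0 1"
    using sets_eq_imp_space_eq[OF sets_\<sigma>] by (simp add: space_restrict_space)
  have id_meas: "(\<lambda>x. x) \<in> borel_measurable \<sigma>"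
    unfolding measurable_cong_sets[OF sets_\<sigma> refl] by (rule measurable_restrict_space1) simp
  \<comment> \<open>The identity map transports \<sigma> from the Borel sets of the sphere to those
    of the whole space, where the two measures can be compared.\<close>
  have "distr \<sigma> borel (\<lambda>x. x) = cylinder_distr a e1 e2"
  proof (rule rotation_invariant_prob_sphere_unique)
    show "prob_space (distr \<sigma> borel (\<lambda>x. x))"
      by (rule prob_space.prob_space_distr[OF prob id_meas])
    show "AE x in distr \<sigma> borel (\<lambda>x. x). x \<in> sphere 0 1"
      by (subst AE_distr_iff[OF id_meas]) (auto intro!: AE_I2 simp: space_\<sigma>)
    show "distr (distr \<sigma> borel (\<lambda>x. x)) borel ((*v) Q) = distr \<sigma> borel (\<lambda>x. x)"
      if Q: "rotation_matrix Q" for Q :: "real^3^3"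
    proof -
      have orth: "orthogonal_transformation ((*v) Q)"
        using Q by (simp add: rotation_matrix_def orthogonal_transformation_matrix)
      have Q_meas: "(*v) Q \<in> borel_measurable borel"
        by (intro borel_measurable_continuous_onI matrix_vector_mult_linear_continuous_on)
      have Q\<sigma>: "(*v) Q \<in> measurable \<sigma> \<sigma>"
        unfolding measurable_cong_sets[OF sets_\<sigma> sets_\<sigma>]
        by (rule measurable_restrict_space2)
          (auto simp: space_restrict_space orthogonal_transformation_norm[OF orth]
            intro: measurable_restrict_space1 Q_meas)
      have "distr (distr \<sigma> borel (\<lambda>x. x)) borel ((*v) Q) = distr (distr \<sigma> \<sigma> ((*v) Q)) borel (\<lambda>x. x)"
        by (subst distr_distr[OF Q_meas id_meas], subst distr_distr[OF id_meas Q\<sigma>]) (simp add: o_def)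
      then show ?thesis
        by (simp add: inv[OF Q])
    qed
    show "AE x in cylinder_distr a e1 e2. x \<in> sphere 0 1"
      by (rule AE_cylinder_distr_sphere[OF frame])
  qed (use frame in \<open>simp_all add: prob_space_cylinder_distr sets_cylinder_distr distr_cylinder_distr_rotation\<close>)
  moreover have "emeasure (distr \<sigma> borel (\<lambda>x. x)) B = emeasure \<sigma> B"
    using B by (subst emeasure_distr[OF id_meas]) (auto simp: space_\<sigma> intro: arg_cong[of _ _ "emeasure \<sigma>"])
  ultimately show ?thesis
    using emeasure_cylinder_distr[OF B(1)] by simp
qed

subsection \<open>Level circles in a cell\<close>

lemma sphere_interior_borel: "sphere_interior C \<in> sets borel"
proof -
  have "openin (top_of_set (sphere 0 1)) (sphere_interior C)"
    by simp
  then obtain T where "open T" "sphere_interior C = sphere 0 1 \<inter> T"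
    unfolding openin_open by blast
  then show ?thesis by auto
qed

lemma sphere_interior_subset: "sphere_interior C \<subseteq> sphere 0 1"
  using interior_of_subset_topspace[of "top_of_set (sphere 0 1)" C] by simp

lemma orthonormal_basis_perp_frame:
  assumes "orthonormal_basis_perp a e1 e2" "a \<noteq> 0"
  shows "orthonormal_frame (a /\<^sub>R norm a) e1 e2"
proof -
  have "e1 \<in> {a}\<^sup>\<bottom>" "e2 \<in> {a}\<^sup>\<bottom>"
    using assms(1) span_base[of e1 "{e1, e2}"] span_base[of e2 "{e1, e2}"]
    by (auto simp: orthonormal_basis_perp_def)
  then have "a \<bullet> e1 = 0" "a \<bullet> e2 = 0"
    by (auto simp: orthogonal_comp_def orthogonal_def inner_commute)
  then show ?thesis
    using assms by (auto simp: orthonormal_basis_perp_def orthonormal_frame_def orthogonal_def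
        dot_square_norm power2_eq_square norm_eq_1 field_simps)
qed

lemma level_circle_point_eq_cylinder_point:
  "level_circle_point a e1 e2 t \<theta> = cylinder_point (a /\<^sub>R norm a) e1 e2 (t / norm a) \<theta>"
  by (simp add: level_circle_point_def cylinder_point_def power_divide)

lemma measurable_level_circle_point [measurable]:
  assumes [measurable]: "f \<in> borel_measurable M" "g \<in> borel_measurable M"
  shows "(\<lambda>x. level_circle_point a e1 e2 (f x) (g x)) \<in> borel_measurable M"
  unfolding level_circle_point_eq_cylinder_point by measurable

text \<open>For each height the aperture is the measure of a section of one measurable set in the
  plane of heights and angles.\<close>

lemma measurable_angular_aperture [measurable]:
  "angular_aperture C a e1 e2 \<in> borel_measurable borel"
proof -
  note [measurable] = sphere_interior_borel
  have "{p \<in> space (borel \<Otimes>\<^sub>M lborel). snd p \<in> {0..<2*pi} \<and>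
      level_circle_point a e1 e2 (fst p) (snd p) \<in> sphere_interior C} \<in> sets (borel \<Otimes>\<^sub>M lborel)"
    by measurable
  from lborel.measurable_emeasure_Pair[OF this] show ?thesis
    unfolding angular_aperture_def[abs_def] by (simp add: vimage_def space_pair_measure)
qed

text \<open>With \<open>r\<close> the radius of the level circle,
  \<open>sqrt ((norm a)\<^sup>2 - t\<^sup>2) = norm a * r\<close>, so \<open>r\<close> cancels
  against the factor between arc length and angle.\<close>

lemma hausdorff1_level_circle_cell:
  assumes frame: "orthonormal_basis_perp a e1 e2" and a: "a \<noteq> 0" and t: "\<bar>t\<bar> < norm a"
  shows "hausdorff1 (sphere_interior C \<inter> level_circle a t) / ennreal (sqrt ((norm a)\<^sup>2 - t\<^sup>2))
    = angular_aperture C a e1 e2 t / ennreal (norm a)"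
proof -
  let ?D = "norm a" and ?p = "level_circle_point a e1 e2 t"
  note fr = orthonormal_basis_perp_frame[OF frame a]
  have D: "?D > 0" using a by simp
  have t2: "(t / ?D)\<^sup>2 < 1"
    using t D by (simp add: abs_square_less_1 abs_divide)
  define r where "r = sqrt (1 - t\<^sup>2 / ?D\<^sup>2)"
  have r: "r > 0"
    using t2 by (simp add: r_def power_divide)
  define T where "T = {\<theta> \<in> {0..<2*pi}. ?p \<theta> \<in> sphere_interior C}"
  have T_borel: "T \<in> sets borel"
  proof -
    note [measurable] = sphere_interior_borel
    show ?thesis unfolding T_def by measurable
  qed
  have inner_a: "a \<bullet> ?p \<theta> = t" for \<theta>
  proof -
    have "a \<bullet> ?p \<theta> = ?D * (?p \<theta> \<bullet> (a /\<^sub>R ?D))"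
      using D by (simp add: inner_commute)
    then show ?thesis
      using D unfolding level_circle_point_eq_cylinder_point cylinder_point_inner(1)[OF fr] by simp
  qed
  have "sphere_interior C \<inter> level_circle a t = ?p ` T"
  proof (intro equalityI subsetI)
    fix u assume u: "u \<in> sphere_interior C \<inter> level_circle a t"
    then have u': "norm u = 1" "u \<bullet> (a /\<^sub>R ?D) = t / ?D"
      by (auto simp: level_circle_def inner_commute divide_inverse mult.commute)
    with t2 have "(u \<bullet> (a /\<^sub>R ?D))\<^sup>2 < 1" by simp
    from cylinder_point_exists[OF fr u'(1) this] obtain \<theta> where
      "0 \<le> \<theta>" "\<theta> < 2 * pi" "u = cylinder_point (a /\<^sub>R ?D) e1 e2 (u \<bullet> (a /\<^sub>R ?D)) \<theta>" by blast
    then have "u = ?p \<theta>" "\<theta> \<in> {0..<2*pi}"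
      unfolding u'(2) level_circle_point_eq_cylinder_point by auto
    moreover from this u have "\<theta> \<in> T"
      by (auto simp: T_def)
    ultimately show "u \<in> ?p ` T"
      by blast
  next
    fix u assume "u \<in> ?p ` T"
    then obtain \<theta> where "u = ?p \<theta>" "?p \<theta> \<in> sphere_interior C"
      by (auto simp: T_def)
    then show "u \<in> sphere_interior C \<inter> level_circle a t"
      using sphere_interior_subset[of C] inner_a[of \<theta>] unfolding level_circle_def by blast
  qed
  also have "?p = (\<lambda>\<theta>. (t / ?D) *\<^sub>R (a /\<^sub>R ?D) + r *\<^sub>R (cos \<theta> *\<^sub>R e1 + sin \<theta> *\<^sub>R e2))"
    by (simp add: fun_eq_iff level_circle_point_def r_def)
  also have "hausdorff1 (\<dots> ` T) = ennreal r * emeasure lborel T"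
    by (rule hausdorff1_circle_arc)
      (use frame r T_borel in \<open>auto simp: orthonormal_basis_perp_def T_def\<close>)
  finally have H: "hausdorff1 (sphere_interior C \<inter> level_circle a t) = ennreal r * angular_aperture C a e1 e2 t"
    by (simp add: angular_aperture_def T_def)
  have "sqrt (?D\<^sup>2 - t\<^sup>2) = sqrt (?D\<^sup>2 * (1 - t\<^sup>2 / ?D\<^sup>2))"
    using D by (simp add: field_simps)
  also have "\<dots> = ?D * r"
    using D by (simp add: real_sqrt_mult r_def)
  finally have "ennreal r * inverse (ennreal (sqrt (?D\<^sup>2 - t\<^sup>2))) = inverse (ennreal ?D)"
    using D r by (simp add: inverse_ennreal ennreal_mult[symmetric])
  then show ?thesis
    unfolding H divide_ennreal_def by (metis mult.assoc mult.commute)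
qed

text \<open>Sections of the cylinder at fixed height have the aperture as their length, and the
  substitution \<open>t = norm a * s\<close> produces the divisor \<open>norm a\<close>.\<close>

lemma rotation_invariant_cell_slice:
  assumes \<sigma>: "rotation_invariant_prob \<sigma>"
    and frame: "orthonormal_basis_perp a e1 e2" and a: "a \<noteq> 0" and T [measurable]: "T \<in> sets borel"
  shows "emeasure \<sigma> {u \<in> sphere_interior C. a \<bullet> u \<in> T}
    = (\<integral>\<^sup>+t. ennreal (1 / (4 * pi)) * (if \<bar>t\<bar> < norm a then angular_aperture C a e1 e2 t / ennreal (norm a) else 0)
        * indicator T t \<partial>lborel)"
proof -
  note [measurable] = sphere_interior_borel
  let ?D = "norm a" and ?\<Theta> = "angular_aperture C a e1 e2"
  note fr = orthonormal_basis_perp_frame[OF frame a]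
  have D: "?D > 0" using a by simp
  let ?c = "cylinder_point (a /\<^sub>R ?D) e1 e2"
  let ?B = "{u \<in> sphere_interior C. a \<bullet> u \<in> T}"
  have B_borel: "?B \<in> sets borel"
    by measurable
  have inner_a: "a \<bullet> ?c s \<theta> = ?D * s" for s \<theta>
  proof -
    have "a \<bullet> ?c s \<theta> = ?D * (?c s \<theta> \<bullet> (a /\<^sub>R ?D))"
      using D by (simp add: inner_commute)
    then show ?thesis
      unfolding cylinder_point_inner(1)[OF fr] .
  qed
  let ?P = "{p \<in> {-1<..<1} \<times> {0<..<2*pi}. ?c (fst p) (snd p) \<in> ?B}"
  have slice: "emeasure lborel (Pair s -` ?P)
      = indicator {-?D<..<?D} (?D * s) * indicator T (?D * s) * ?\<Theta> (?D * s)" for s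
  proof (cases "-1 < s \<and> s < 1 \<and> ?D * s \<in> T")
    case True
    have "?D * s \<in> {-?D<..<?D}"
      using True D mult_strict_left_mono[of s 1 ?D] mult_strict_left_mono[of "-1" s ?D] by simp
    \<comment> \<open>The cylinder uses an open range of angles, the aperture one that contains 0;
      the difference is at most one point.\<close>
    have "Pair s -` ?P = {\<theta> \<in> {0..<2*pi}. level_circle_point a e1 e2 (?D * s) \<theta> \<in> sphere_interior C} - {0}"
      using True D by (auto simp: inner_a level_circle_point_eq_cylinder_point)
    also have "emeasure lborel \<dots> = ?\<Theta> (?D * s)"
      unfolding angular_aperture_def
    proof (rule emeasure_Diff_null_set)
      show "{\<theta> \<in> {0..<2*pi}. level_circle_point a e1 e2 (?D * s) \<theta> \<in> sphere_interior C} \<in> sets lborel"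
        by measurable
    qed (auto simp: null_sets_def)
    finally show ?thesis
      using True \<open>?D * s \<in> {-?D<..<?D}\<close> by simp
  next
    case False
    have empty: "Pair s -` ?P = {}"
      using False by (auto simp: inner_a)
    have "?D * s \<notin> {-?D<..<?D} \<or> ?D * s \<notin> T"
    proof (cases "-1 < s \<and> s < 1")
      case True
      with False show ?thesis by blast
    next
      case out: False
      then have "s \<le> -1 \<or> 1 \<le> s" by auto
      then have "?D * s \<le> ?D * (-1) \<or> ?D * 1 \<le> ?D * s"
        using D mult_left_mono[of s "-1" ?D] mult_left_mono[of 1 s ?D] by auto
      then show ?thesis by auto
    qed
    then show ?thesis
      unfolding empty by (auto simp: indicator_def)
  qed
  define G where "G t = indicator {-?D<..<?D} t * indicator T t * ?\<Theta> t" for t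
  have [measurable]: "G \<in> borel_measurable borel"
    unfolding G_def by measurable
  have P_meas: "?P \<in> sets (lborel \<Otimes>\<^sub>M lborel)"
    by measurable
  have "emeasure (lborel \<Otimes>\<^sub>M lborel) ?P = (\<integral>\<^sup>+s. G (?D * s) \<partial>lborel)"
    unfolding lborel.emeasure_pair_measure_alt[OF P_meas] slice G_def ..
  also have "\<dots> = (\<integral>\<^sup>+t. G t \<partial>lborel) / ennreal ?D"
  proof -
    have "(\<integral>\<^sup>+t. G t \<partial>lborel) = (\<integral>\<^sup>+s. G (?D * s) \<partial>lborel) * ennreal ?D"
      using D nn_integral_real_affine[of G ?D 0] by (simp add: mult.commute)
    then show ?thesis
      using D by (simp add: ennreal_mult_divide_eq)
  qed
  also have "\<dots> = (\<integral>\<^sup>+t. G t / ennreal ?D \<partial>lborel)"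
    by (simp add: nn_integral_divide)
  finally have "emeasure \<sigma> ?B = ennreal (1 / (4 * pi)) * (\<integral>\<^sup>+t. G t / ennreal ?D \<partial>lborel)"
    using emeasure_rotation_invariant_prob[OF \<sigma> fr B_borel] sphere_interior_subset[of C] by auto
  also have "\<dots> = (\<integral>\<^sup>+t. ennreal (1 / (4 * pi)) * (G t / ennreal ?D) \<partial>lborel)"
    by (simp add: nn_integral_cmult)
  also have "\<dots> = (\<integral>\<^sup>+t. ennreal (1 / (4 * pi)) * (if \<bar>t\<bar> < norm a then ?\<Theta> t / ennreal ?D else 0)
        * indicator T t \<partial>lborel)"
    by (intro nn_integral_cong) (auto simp: G_def indicator_def abs_less_iff)
  finally show ?thesis .
qed

section \<open>The law of F(U)\<close>

theorem theorem3p1: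
  fixes \<sigma> :: "(real^3) measure"
    and \<C> :: "(real^3) set set"
    and F :: "real^3 \<Rightarrow> real"
    and a e1 e2 :: "(real^3) set \<Rightarrow> real^3"
    and M :: "'m measure"
    and U :: "'m \<Rightarrow> real^3"
  assumes sigma: "rotation_invariant_prob \<sigma>"
    and fin: "finite \<C>"
    and cells: "\<And>C. C \<in> \<C> \<Longrightarrow> spherical_cell C"
    and disj: "pairwise (\<lambda>C C'. disjnt (sphere_interior C) (sphere_interior C')) \<C>"
    and cover: "emeasure \<sigma> (sphere 0 1 - (\<Union>C\<in>\<C>. sphere_interior C)) = 0"
    and F_meas: "F \<in> borel_measurable (restrict_space borel (sphere 0 1))"
    and a_nonzero: "\<And>C. C \<in> \<C> \<Longrightarrow> a C \<noteq> 0"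
    and F_linear: "\<And>C u. C \<in> \<C> \<Longrightarrow> u \<in> sphere_interior C \<Longrightarrow> F u = a C \<bullet> u"
    and frame: "\<And>C. C \<in> \<C> \<Longrightarrow> orthonormal_basis_perp (a C) (e1 C) (e2 C)"
    and prob: "prob_space M"
    and U_meas: "U \<in> measurable M \<sigma>"
    and U_unif: "distr M \<sigma> U = \<sigma>"
  shows "absolutely_continuous lborel (distr M lborel (\<lambda>\<omega>. F (U \<omega>))) \<and>
    (\<forall>x. emeasure (distr M lborel (\<lambda>\<omega>. F (U \<omega>))) {x} = 0) \<and>
    (\<exists>f. distributed M lborel (\<lambda>\<omega>. F (U \<omega>)) f \<and>
      (AE t in lborel.
         f t = ennreal (1 / (4 * pi)) *
           (\<Sum>C | C \<in> \<C> \<and> \<bar>t\<bar> < norm (a C).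
              hausdorff1 (sphere_interior C \<inter> level_circle (a C) t)
                / ennreal (sqrt ((norm (a C))\<^sup>2 - t\<^sup>2))) \<and>
         f t = ennreal (1 / (4 * pi)) *
           (\<Sum>C | C \<in> \<C> \<and> \<bar>t\<bar> < norm (a C).
              angular_aperture C (a C) (e1 C) (e2 C) t / ennreal (norm (a C)))))"
proof -
  have prob_\<sigma>: "prob_space \<sigma>" and sets_\<sigma>: "sets \<sigma> = sets (restrict_space borel (sphere 0 1))"
    using sigma by (auto simp: rotation_invariant_prob_def)
  interpret \<sigma>: prob_space \<sigma> by fact
  have space_\<sigma>: "space \<sigma> = sphere 0 1"
    using sets_eq_imp_space_eq[OF sets_\<sigma>] by (simp add: space_restrict_space)
  have sets_\<sigma>I: "A \<in> sets \<sigma>" if "A \<in> sets borel" "A \<subseteq> sphere 0 1" for A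
    using that by (auto simp: sets_\<sigma> sets_restrict_space_iff)
  have F_\<sigma>: "F \<in> borel_measurable \<sigma>"
    using F_meas by (simp add: measurable_cong_sets[OF sets_\<sigma> refl])
  let ?X = "\<lambda>\<omega>. F (U \<omega>)"
  have X: "?X \<in> measurable M lborel"
    using measurable_compose[OF U_meas F_\<sigma>] by simp
  \<comment> \<open>The aperture form is taken as the density because its measurability is at hand;
    the form with H^1 agrees with it at every \<open>t\<close>, not only almost everywhere.\<close>
  define f where "f t = ennreal (1 / (4 * pi)) * (\<Sum>C | C \<in> \<C> \<and> \<bar>t\<bar> < norm (a C).
      angular_aperture C (a C) (e1 C) (e2 C) t / ennreal (norm (a C)))" for t
  \<comment> \<open>Extension by zero makes the index set of the sum independent of
    \<open>t\<close>, so that sum and integral can be exchanged.\<close>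
  let ?g = "\<lambda>C t. if \<bar>t\<bar> < norm (a C) then angular_aperture C (a C) (e1 C) (e2 C) t / ennreal (norm (a C)) else 0"
  have f: "f t = (\<Sum>C\<in>\<C>. ennreal (1 / (4 * pi)) * ?g C t)" for t
    unfolding f_def by (simp add: sum.inter_filter[OF fin] sum_distrib_left)
  have f_meas: "f \<in> borel_measurable lborel"
    unfolding f[abs_def] by measurable
  have law: "distr M lborel ?X = density lborel f"
  proof (rule measure_eqI)
    fix T assume "T \<in> sets (distr M lborel ?X)"
    then have T [measurable]: "T \<in> sets borel" by simp
    let ?A = "F -` T \<inter> space \<sigma>"
    let ?I = "\<Union>C\<in>\<C>. sphere_interior C"
    let ?s = "\<lambda>C. {u \<in> sphere_interior C. a C \<bullet> u \<in> T}"
    have s_sets: "?s C \<in> sets \<sigma>" for C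
    proof (rule sets_\<sigma>I)
      note [measurable] = sphere_interior_borel
      show "?s C \<in> sets borel" by measurable
    qed (use sphere_interior_subset in blast)
    have null: "space \<sigma> - ?I \<in> null_sets \<sigma>"
    proof (rule null_setsI)
      have "?I \<in> sets \<sigma>"
        using fin sphere_interior_borel sphere_interior_subset
        by (intro sets.finite_UN sets_\<sigma>I) auto
      then show "space \<sigma> - ?I \<in> sets \<sigma>" by auto
    qed (use cover space_\<sigma> in simp)
    have "emeasure (distr M lborel ?X) T = emeasure M (U -` ?A \<inter> space M)"
      using measurable_space[OF U_meas]
      by (subst emeasure_distr[OF X]) (auto intro!: arg_cong[of _ _ "emeasure M"])
    also have "\<dots> = emeasure (distr M \<sigma> U) ?A"
      by (rule emeasure_distr[symmetric, OF U_meas measurable_sets[OF F_\<sigma> T]])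
    also have "\<dots> = emeasure \<sigma> ?A"
      by (simp add: U_unif)
    \<comment> \<open>Outside the null set left uncovered, \<open>u\<close> lies in the interior of
      some cell, where \<open>F u \<in> T\<close> is a condition on a linear form.\<close>
    also have "\<dots> = emeasure \<sigma> (\<Union>C\<in>\<C>. ?s C)"
    proof (rule emeasure_eq_AE)
      show "AE u in \<sigma>. u \<in> ?A \<longleftrightarrow> u \<in> (\<Union>C\<in>\<C>. ?s C)"
        using AE_not_in[OF null] AE_space
      proof eventually_elim
        case (elim u)
        have eq: "u \<in> ?s C \<longleftrightarrow> F u \<in> T" if "C \<in> \<C>" "u \<in> sphere_interior C" for C
          using F_linear[OF that] that by simp
        from elim obtain C where "C \<in> \<C>" "u \<in> sphere_interior C" by blast
        with eq elim show ?case by blast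
      qed
      show "?A \<in> sets \<sigma>"
        by (rule measurable_sets[OF F_\<sigma> T])
      show "(\<Union>C\<in>\<C>. ?s C) \<in> sets \<sigma>"
        using fin s_sets by (intro sets.finite_UN) auto
    qed
    also have "\<dots> = (\<Sum>C\<in>\<C>. emeasure \<sigma> (?s C))"
    proof (rule sum_emeasure[symmetric])
      show "?s ` \<C> \<subseteq> sets \<sigma>"
        using s_sets by blast
      show "disjoint_family_on ?s \<C>"
        using disj by (fastforce simp: disjoint_family_on_def pairwise_def disjnt_def)
    qed (rule fin)
    also have "\<dots> = (\<Sum>C\<in>\<C>. \<integral>\<^sup>+t. ennreal (1 / (4 * pi)) * ?g C t * indicator T t \<partial>lborel)"
      using rotation_invariant_cell_slice[OF sigma frame a_nonzero T] by (intro sum.cong refl) blast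
    also have "\<dots> = (\<integral>\<^sup>+t. f t * indicator T t \<partial>lborel)"
      by (subst nn_integral_sum[symmetric]) (auto simp: f sum_distrib_right)
    also have "\<dots> = emeasure (density lborel f) T"
      using f_meas by (simp add: emeasure_density)
    finally show "emeasure (distr M lborel ?X) T = emeasure (density lborel f) T" .
  qed simp
  have ac: "absolutely_continuous lborel (distr M lborel ?X)"
    unfolding law by (rule absolutely_continuousI_density[OF f_meas])
  have atom: "emeasure (distr M lborel ?X) {x} = 0" for x
  proof -
    have "{x} \<in> null_sets lborel"
      by (auto simp: null_sets_def)
    then show ?thesis
      using ac by (auto simp: absolutely_continuous_def)
  qed
  have "distributed M lborel ?X f"
    unfolding distributed_def using law f_meas X by simp
  moreover have "f t = ennreal (1 / (4 * pi)) * (\<Sum>C | C \<in> \<C> \<and> \<bar>t\<bar> < norm (a C).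
      hausdorff1 (sphere_interior C \<inter> level_circle (a C) t) / ennreal (sqrt ((norm (a C))\<^sup>2 - t\<^sup>2)))" for t
    unfolding f_def using hausdorff1_level_circle_cell[OF frame a_nonzero]
    by (intro arg_cong2[where f="(*)"] refl sum.cong) auto
  ultimately show ?thesis
    using ac atom f_def by (intro conjI exI[of _ f] allI AE_I2) blast+
qed

end
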